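(* Let $\mathcal{C}$ be a class of IK-AoN instances and let $\alpha\in[0,1]$. Suppose there is an algorithm that, for each instance $\overline{\mathcal I}$ in the modularization $\overline{\mathcal C}$ of $\mathcal C$, outputs in time $q(|\overline{\mathcal I}|)$ an $\alpha$-approximate solution to $\overline{\mathcal I}$. Then there is an algorithm that, for each instance $\mathcal I\in\mathcal C$ defined over $n$ items and with aggregation function $\gamma$, outputs in time $q(|\mathcal I|)+O(n\log n)+n\cdot \texttt{oracle}$ an $\alpha$-approximate solution to $\mathcal I$, where $\texttt{oracle}$ is the time required for one evaluation of $\gamma$ (the algorithm has oracle access to $\gamma$).
   Context: An instance of the Monotone Submodular All-or-Nothing Incremental Knapsack problem (IK-AoN) consists of: a set $[n]=\{1,\dots,n\}$ of items, each with a nonnegative weight $w_i$ and a profit $p_i\in\mathbb N=\{1,2,\dots\}$; a number $T$ of times, each $t\in[T]$ with a coefficient $\Delta_t\in\mathbb Z_+=\{0,1,2,\dots\}$ and a capacity $W_t\in\mathbb N$, where $W_1\le W_2\le\dots\le W_T$; and an aggregation function $\gamma:2^{[n]}\to\mathbb Z_+$ with $\gamma(\emptyset)=0$ that is monotonically non-decreasing and submodular (for $i\in[n]$ and $S\subseteq R\subseteq[n]$, $\gamma(S\cup\{i\})-\gamma(S)\ge\gamma(R\cup\{i\})-\gamma(R)$), and satisfies the all-or-nothing property: for each $i\in[n]$ and $S\subseteq[n]$, $\gamma(S\cup\{i\})-\gamma(S)\in\{0,p_i\}$. For $g$ indexed by $[n]$ and $S\subseteq[n]$, write $g(S)=\sum_{i\in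 S}g_i$. A chain is a family $S_1\subseteq S_2\subseteq\dots\subseteq S_T\subseteq[n]$; it is feasible if $w(S_t)\le W_t$ for all $t\in[T]$. The goal is to find a feasible chain maximizing $\sum_{t\in[T]}\Delta_t\gamma(S_t)$. An $\alpha$-approximate solution is a feasible chain whose objective value is at least $\alpha$ times the optimum. The special case where $\gamma(S)=p(S)$ for all $S$ is called IK (Incremental Knapsack). A modularization of an IK-AoN instance $\mathcal I$ is any IK instance obtained by dropping some of the items (the remaining items form the new item set) and keeping the same profits, weights, coefficients and capacities, with aggregation function $\gamma'(S)=p(S)$ for subsets $S$ of the remaining items. For a family $\mathcal C$ of IK-AoN instances, its modularization $\overline{\mathcal C}$ is the family of all modularizations of all instances in $\mathcal C$. $|\mathcal I|$ denotes the input size of an instance $\mathcal I$.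
   Formalization: The running-time bound q is assumed to be non-decreasing; without this the claim can fail, since a modularization with fewer items could be allowed more time than q(|I|). *)

theory Defs
  imports Complex_Main "HOL-Library.Landau_Symbols"
begin

text \<open>
  An item set is a finite set of natural-number labels, so that an instance keeps its labels when
  items are dropped; \<open>{1..n}\<close> is the special case of the initial instance. Times are
  \<open>1, \<dots>, horizon\<close>. The values of the functions outside their index sets are irrelevant.
\<close>

record ik_instance =
  items :: "nat set"
  weight :: "nat \<Rightarrow> real"
  profit :: "nat \<Rightarrow> nat"
  horizon :: nat
  coeff :: "nat \<Rightarrow> nat"
  capacity :: "nat \<Rightarrow> nat"
  agg :: "nat set \<Rightarrow> nat"

definition ik_aon :: "ik_instance \<Rightarrow> bool" where
  "ik_aon I \<longleftrightarrow>
     finite (items I) \<and>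
     (\<forall>i\<in>items I. 0 \<le> weight I i) \<and>
     (\<forall>i\<in>items I. 1 \<le> profit I i) \<and>
     (\<forall>t\<in>{1..horizon I}. 1 \<le> capacity I t) \<and>
     (\<forall>s\<in>{1..horizon I}. \<forall>t\<in>{1..horizon I}. s \<le> t \<longrightarrow> capacity I s \<le> capacity I t) \<and>
     agg I {} = 0 \<and>
     (\<forall>S R. S \<subseteq> R \<and> R \<subseteq> items I \<longrightarrow> agg I S \<le> agg I R) \<and>
     (\<forall>i\<in>items I. \<forall>S R. S \<subseteq> R \<and> R \<subseteq> items I \<longrightarrow>
        int (agg I (S \<union> {i})) - int (agg I S) \<ge> int (agg I (R \<union> {i})) - int (agg I R)) \<and>
     (\<forall>i\<in>items I. \<forall>S. S \<subseteq> items I \<longrightarrow>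
        int (agg I (S \<union> {i})) - int (agg I S) \<in> {0, int (profit I i)})"

definition feasible_chain :: "ik_instance \<Rightarrow> (nat \<Rightarrow> nat set) \<Rightarrow> bool" where
  "feasible_chain I S \<longleftrightarrow>
     (\<forall>s\<in>{1..horizon I}. \<forall>t\<in>{1..horizon I}. s \<le> t \<longrightarrow> S s \<subseteq> S t) \<and>
     (\<forall>t\<in>{1..horizon I}. S t \<subseteq> items I) \<and>
     (\<forall>t\<in>{1..horizon I}. (\<Sum>i\<in>S t. weight I i) \<le> real (capacity I t))"

definition objective :: "ik_instance \<Rightarrow> (nat \<Rightarrow> nat set) \<Rightarrow> nat" where
  "objective I S = (\<Sum>t=1..horizon I. coeff I t * agg I (S t))"

definition optimum :: "ik_instance \<Rightarrow> nat" where
  "optimum I = Max {objective I S |S. feasible_chain I S}"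

definition approx_solution :: "real \<Rightarrow> ik_instance \<Rightarrow> (nat \<Rightarrow> nat set) \<Rightarrow> bool" where
  "approx_solution \<alpha> I S \<longleftrightarrow>
     feasible_chain I S \<and> real (objective I S) \<ge> \<alpha> * real (optimum I)"

definition modularizations :: "ik_instance set \<Rightarrow> ik_instance set" where
  "modularizations C =
     {I\<lparr>items := J, agg := (\<lambda>S. \<Sum>i\<in>S. profit I i)\<rparr> |I J. I \<in> C \<and> J \<subseteq> items I}"

text \<open>
  Input size: the total length of the numbers in the input, where \<open>len\<close> is the length of a single
  number (constantly 1 for the number of machine words, the bit length for a binary encoding).
  The aggregation function is not part of the encoded input, being given by an oracle, or
  determined by the profits.
\<close>

definition input_size :: "(real \<Rightarrow> nat) \<Rightarrow> ik_instance \<Rightarrow> nat" where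
  "input_size len I =
     (\<Sum>i\<in>items I. len (real i) + len (weight I i) + len (real (profit I i))) +
     (\<Sum>t=1..horizon I. len (real (coeff I t)) + len (real (capacity I t)))"

text \<open>
  Algorithms are programs of a unit-cost random access machine with structured control flow.
  A memory cell holds a number; scalars and arrays are named, and arrays are addressed
  indirectly. Besides addition and subtraction, the machine has a further, arbitrary collection
  \<open>'op\<close> of unit-cost binary operations (multiplication, integer division, bit operations, \dots).
  Only natural-number constants can occur in a program.
\<close>

type_synonym name = string

datatype 'op com =
    Skip
  | Const name nat
  | Copy name name
  | Add name name name
  | Sub name name name
  | Prim 'op name name name
  | Load name name name
  | Store name name name
  | Oracle name name
  | Seq "'op com" "'op com"
  | IfLess name name "'op com" "'op com"
  | WhileLess name name "'op com"

record store =
  var :: "name \<Rightarrow> real"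
  arr :: "name \<Rightarrow> nat \<Rightarrow> real"

definition set_var :: "name \<Rightarrow> real \<Rightarrow> store \<Rightarrow> store" where
  "set_var x v s = s\<lparr>var := (var s)(x := v)\<rparr>"

definition set_arr :: "name \<Rightarrow> nat \<Rightarrow> real \<Rightarrow> store \<Rightarrow> store" where
  "set_arr a i v s = s\<lparr>arr := (arr s)(a := (arr s a)(i := v))\<rparr>"

text \<open>
  \<open>exec prim orc \<tau> c s k s'\<close>: started in \<open>s\<close>, program \<open>c\<close> halts in \<open>s'\<close> after time \<open>k\<close>. Every
  elementary instruction and every test costs 1, an oracle call costs \<open>\<tau>\<close>. \<open>Oracle x a\<close> queries the
  set whose indicator is held in array \<open>a\<close>. Execution gets stuck on array addresses that are not
  natural numbers and on queries outside the domain of \<open>orc\<close>; \<open>orc = Map.empty\<close> means that there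
  is no oracle.
\<close>

inductive exec ::
  "('op \<Rightarrow> real \<Rightarrow> real \<Rightarrow> real) \<Rightarrow> (nat set \<rightharpoonup> nat) \<Rightarrow> nat \<Rightarrow>
   'op com \<Rightarrow> store \<Rightarrow> nat \<Rightarrow> store \<Rightarrow> bool"
  for prim :: "'op \<Rightarrow> real \<Rightarrow> real \<Rightarrow> real" and orc :: "nat set \<rightharpoonup> nat" and \<tau> :: nat
where
  Skip: "exec prim orc \<tau> Skip s 1 s"
| Const: "exec prim orc \<tau> (Const x m) s 1 (set_var x (real m) s)"
| Copy: "exec prim orc \<tau> (Copy x y) s 1 (set_var x (var s y) s)"
| Add: "exec prim orc \<tau> (Add x y z) s 1 (set_var x (var s y + var s z) s)"
| Sub: "exec prim orc \<tau> (Sub x y z) s 1 (set_var x (var s y - var s z) s)"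
| Prim: "exec prim orc \<tau> (Prim f x y z) s 1 (set_var x (prim f (var s y) (var s z)) s)"
| Load: "var s y = real i \<Longrightarrow> exec prim orc \<tau> (Load x a y) s 1 (set_var x (arr s a i) s)"
| Store: "var s x = real i \<Longrightarrow> exec prim orc \<tau> (Store a x y) s 1 (set_arr a i (var s y) s)"
| Oracle: "orc {i. arr s a i \<noteq> 0} = Some v \<Longrightarrow>
    exec prim orc \<tau> (Oracle x a) s \<tau> (set_var x (real v) s)"
| Seq: "exec prim orc \<tau> c s k s' \<Longrightarrow> exec prim orc \<tau> d s' l s'' \<Longrightarrow>
    exec prim orc \<tau> (Seq c d) s (k + l) s''"
| IfTrue: "var s x < var s y \<Longrightarrow> exec prim orc \<tau> c s k s' \<Longrightarrow>
    exec prim orc \<tau> (IfLess x y c d) s (1 + k) s'"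
| IfFalse: "\<not> var s x < var s y \<Longrightarrow> exec prim orc \<tau> d s k s' \<Longrightarrow>
    exec prim orc \<tau> (IfLess x y c d) s (1 + k) s'"
| WhileTrue: "var s x < var s y \<Longrightarrow> exec prim orc \<tau> c s k s' \<Longrightarrow>
    exec prim orc \<tau> (WhileLess x y c) s' l s'' \<Longrightarrow>
    exec prim orc \<tau> (WhileLess x y c) s (1 + k + l) s''"
| WhileFalse: "\<not> var s x < var s y \<Longrightarrow> exec prim orc \<tau> (WhileLess x y c) s 1 s"

lemma exec_deterministic:
  assumes "exec prim orc \<tau> c s k s'" and "exec prim orc \<tau> c s l s''"
  shows "l = k \<and> s'' = s'"
  using assms
proof (induction arbitrary: l s'' rule: exec.induct)
  case (Seq c s k s' d m s3)
  from Seq.prems show ?case by (cases rule: exec.cases) (use Seq.IH in blast)+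
next
  case (WhileTrue s x y c k s' m s3)
  from WhileTrue.prems show ?case
    by (cases rule: exec.cases) (use WhileTrue.IH WhileTrue.hyps in blast)+
qed (erule exec.cases; fastforce)+

text \<open>
  Input and output conventions. Array \<open>item\<close> lists the labels in increasing order from address 0 on;
  weights and profits are addressed by label, coefficients and capacities by time. All other
  memory cells are initially 0. An output assigns to each item, in array \<open>out\<close>, the time at which it
  enters the chain, where 0 means never.
\<close>

definition input_store :: "ik_instance \<Rightarrow> store" where
  "input_store I = \<lparr>
     var = (\<lambda>x. if x = ''n'' then real (card (items I))
                else if x = ''T'' then real (horizon I)
                else 0),
     arr = (\<lambda>a k. if a = ''item'' \<and> k < card (items I)
                    then real (sorted_list_of_set (items I) ! k)
                  else if a = ''w'' \<and> k \<in> items I then weight I k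
                  else if a = ''p'' \<and> k \<in> items I then real (profit I k)
                  else if a = ''Delta'' \<and> k \<in> {1..horizon I} then real (coeff I k)
                  else if a = ''W'' \<and> k \<in> {1..horizon I} then real (capacity I k)
                  else 0)\<rparr>"

definition output_chain :: "store \<Rightarrow> nat \<Rightarrow> nat set" where
  "output_chain s t = {i. 0 < arr s ''out'' i \<and> arr s ''out'' i \<le> real t}"

definition agg_oracle :: "ik_instance \<Rightarrow> nat set \<rightharpoonup> nat" where
  "agg_oracle I S = (if S \<subseteq> items I then Some (agg I S) else None)"

definition solves_within ::
  "('op \<Rightarrow> real \<Rightarrow> real \<Rightarrow> real) \<Rightarrow> (nat set \<rightharpoonup> nat) \<Rightarrow> nat \<Rightarrow> 'op com \<Rightarrow>
   real \<Rightarrow> ik_instance \<Rightarrow> real \<Rightarrow> bool" where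
  "solves_within prim orc \<tau> c \<alpha> I b \<longleftrightarrow>
     (\<exists>k s. exec prim orc \<tau> c (input_store I) k s \<and> real k \<le> b \<and>
            approx_solution \<alpha> I (output_chain s))"

end

theory Submission
  imports Defs "HOL-Library.FuncSet" "HOL-Library.Multiset"
begin

text \<open>
  By the all-or-nothing property, items of different profits do not interact, and within one profit
  class the aggregation function is a multiple of a matroid rank function. Scanning the items by
  increasing weight and keeping those with positive marginal value yields a set \<open>J\<close> that is a
  minimum-weight basis in every class. On subsets of \<open>J\<close> the aggregation function is the total
  profit. Conversely, every chain contains a chain of independent sets of the same value, and an
  independent set embeds into \<open>J\<close> by an injection that preserves profits and does not increase
  weights. So restricting to \<open>J\<close> does not lower the optimum. The scan needs one sort (bottom-up merge
  sort) and one oracle call per item.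
\<close>

section \<open>The greedy modularization\<close>

text \<open>On the combinatorial side the obstacle is nestedness: choosing an independent subset of
  each \<open>S t\<close> separately and embedding it into the greedy set could destroy the chain. A
  single independent set is therefore built whose trace on every \<open>S t\<close> has full value,
  and a single injection moves all traces at once. On the machine side, the operations in
  \<open>prim\<close> are arbitrary and programs have no procedures, so the preprocessing may rely
  only on addition, subtraction, tests and array access. Doubling a run length needs nothing more,
  which is why the merge sort is bottom-up. The oracle budget leaves no room for a second query per
  item, so the value of the current greedy set is kept in a variable.\<close>

definition indep :: "ik_instance \<Rightarrow> nat set \<Rightarrow> bool" where
  "indep I S \<longleftrightarrow> agg I S = (\<Sum>i\<in>S. profit I i)"

definition greedy_step :: "ik_instance \<Rightarrow> nat set \<Rightarrow> nat \<Rightarrow> nat set" where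
  "greedy_step I A x = (if agg I A < agg I (insert x A) then insert x A else A)"

definition greedy :: "ik_instance \<Rightarrow> nat list \<Rightarrow> nat set" where
  "greedy I xs = foldl (greedy_step I) {} xs"

definition modularize :: "ik_instance \<Rightarrow> nat set \<Rightarrow> ik_instance" where
  "modularize I J = I\<lparr>items := J, agg := (\<lambda>S. \<Sum>i\<in>S. profit I i)\<rparr>"

section \<open>Matroid structure of an all-or-nothing function\<close>

context
  fixes I :: ik_instance
  assumes aon: "ik_aon I"
begin

lemma finite_items: "finite (items I)"
  using aon by (simp add: ik_aon_def)

lemma finite_sub: "S \<subseteq> items I \<Longrightarrow> finite S"
  using finite_items finite_subset by blast

lemma weight_nonneg: "i \<in> items I \<Longrightarrow> 0 \<le> weight I i"
  using aon by (simp add: ik_aon_def)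

lemma profit_pos: "i \<in> items I \<Longrightarrow> 1 \<le> profit I i"
  using aon by (simp add: ik_aon_def)

lemma agg_empty: "agg I {} = 0"
  using aon by (simp add: ik_aon_def)

lemma agg_mono: "S \<subseteq> R \<Longrightarrow> R \<subseteq> items I \<Longrightarrow> agg I S \<le> agg I R"
  using aon unfolding ik_aon_def by blast

lemma agg_submodular:
  assumes "i \<in> items I" "S \<subseteq> R" "R \<subseteq> items I"
  shows "agg I (insert i R) + agg I S \<le> agg I (insert i S) + agg I R"
proof -
  have "int (agg I (S \<union> {i})) - int (agg I S) \<ge> int (agg I (R \<union> {i})) - int (agg I R)"
    using aon assms unfolding ik_aon_def by blast
  then show ?thesis by simp
qed

lemma agg_insert_cases:
  assumes "i \<in> items I" "S \<subseteq> items I"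
  shows "agg I (insert i S) = agg I S \<or> agg I (insert i S) = agg I S + profit I i"
proof -
  have "int (agg I (S \<union> {i})) - int (agg I S) \<in> {0, int (profit I i)}"
    using aon assms unfolding ik_aon_def by blast
  then show ?thesis by auto
qed

lemma agg_union_le:
  assumes "S \<subseteq> items I" "D \<subseteq> items I"
  shows "agg I (S \<union> D) \<le> agg I S + (\<Sum>i\<in>D. profit I i)"
  using finite_sub[OF assms(2)] assms(2)
proof (induction D rule: finite_induct)
  case (insert x D)
  have "agg I (insert x (S \<union> D)) \<le> agg I (S \<union> D) + profit I x"
    using agg_insert_cases[of x "S \<union> D"] insert assms(1) by auto
  with insert show ?case by simp
qed simp

text \<open>Equality in this bound defines \<open>indep\<close>; it is independence in the direct
  sum of the matroids of the profit classes.\<close>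

lemma agg_le_profit: "S \<subseteq> items I \<Longrightarrow> agg I S \<le> (\<Sum>i\<in>S. profit I i)"
  using agg_union_le[of "{}" S] agg_empty by simp

text \<open>The items of \<open>R - S\<close> add at most their profits, so a deficit of
  \<open>S\<close> would persist in \<open>R\<close>.\<close>

lemma indep_subset:
  assumes "indep I R" "S \<subseteq> R" "R \<subseteq> items I"
  shows "indep I S"
proof -
  have "agg I R \<le> agg I S + (\<Sum>i\<in>R - S. profit I i)"
    using agg_union_le[of S "R - S"] assms(2,3) by (simp add: Un_absorb1 subset_iff)
  moreover have "(\<Sum>i\<in>R. profit I i) = (\<Sum>i\<in>R - S. profit I i) + (\<Sum>i\<in>S. profit I i)"
    using assms(2) finite_sub[OF assms(3)] by (rule sum.subset_diff)
  ultimately show ?thesis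
    using agg_le_profit[of S] assms unfolding indep_def by force
qed

text \<open>By submodularity the marginal value of \<open>x\<close> over \<open>S \<union> D\<close>
  is at most the one over \<open>S\<close>, which is zero; hence spanned items can be added one
  after another.\<close>

lemma agg_union_spanned:
  assumes "S \<subseteq> items I" "R \<subseteq> items I" "\<And>i. i \<in> R \<Longrightarrow> agg I (insert i S) = agg I S"
  shows "agg I (S \<union> R) = agg I S"
  using finite_sub[OF assms(2)] assms(2,3)
proof (induction R rule: finite_induct)
  case (insert x D)
  have "agg I (insert x (S \<union> D)) + agg I S \<le> agg I (insert x S) + agg I (S \<union> D)"
    using agg_submodular[of x S "S \<union> D"] insert.prems assms(1) by auto
  moreover have "agg I S \<le> agg I (insert x (S \<union> D))"
    using agg_mono[of S "insert x (S \<union> D)"] insert.prems assms(1) by auto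
  ultimately show ?case using insert by simp
qed simp

text \<open>Items of different profits do not interact: if \<open>j\<close> blocked \<open>i\<close>, adding both would gain exactly
  \<open>profit I j\<close>, whereas adding \<open>i\<close> first shows the gain to be \<open>profit I i\<close> or
  \<open>profit I i + profit I j\<close>.\<close>

lemma spanned_without_other_profits:
  assumes "indep I J" "J \<subseteq> items I" "i \<in> items I" "agg I (insert i J) = agg I J"
    and "D \<subseteq> J" "\<And>j. j \<in> D \<Longrightarrow> profit I j \<noteq> profit I i"
  shows "agg I (insert i (J - D)) = agg I (J - D)"
  using finite_sub[of D] assms(2,5,6)
proof (induction D rule: infinite_finite_induct)
  case (insert j D)
  define K where "K = J - insert j D"
  have J: "J - D = insert j K" using insert by (auto simp: K_def)
  have K: "K \<subseteq> items I" "j \<in> items I" "j \<notin> K" using assms(2) insert by (auto simp: K_def)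
  have "indep I (insert j K)" "indep I K"
    using indep_subset[OF assms(1)] assms(2) J by (metis Diff_subset, metis Diff_subset K_def)
  then have j: "agg I (insert j K) = agg I K + profit I j"
    using K finite_sub[of K] by (simp add: indep_def)
  have "agg I (insert i (insert j K)) = agg I (insert j K)"
    using insert J by auto
  then have "agg I (insert j (insert i K)) = agg I K + profit I j"
    using j by (simp add: insert_commute)
  moreover have "agg I (insert j (insert i K)) = agg I (insert i K) \<or>
      agg I (insert j (insert i K)) = agg I (insert i K) + profit I j"
    using agg_insert_cases[of j "insert i K"] K assms(3) by simp
  moreover have "agg I (insert i K) = agg I K \<or> agg I (insert i K) = agg I K + profit I i"
    using agg_insert_cases[of i K] K assms(3) by simp
  moreover have "profit I j \<noteq> profit I i" using insert by simp
  ultimately have "agg I (insert i K) = agg I K"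
    using profit_pos[OF assms(3)] by linarith
  then show ?case by (simp add: K_def)
qed (use assms in auto)

text \<open>\<open>J\<close> spans \<open>R\<close>. After removal of the other profits, the class
  part of \<open>J\<close> alone still spans the class part of \<open>B\<close>. On independent sets
  within a class the value is \<open>c\<close> times the cardinality, and \<open>1 \<le> c\<close>
  allows cancelling.\<close>

lemma indep_card_class_le:
  assumes J: "indep I J" "J \<subseteq> R" "agg I J = agg I R" and R: "R \<subseteq> items I"
    and B: "indep I B" "B \<subseteq> R" and c: "1 \<le> c"
  shows "card {i\<in>B. profit I i = c} \<le> card {i\<in>J. profit I i = c}"
proof -
  let ?J = "{i\<in>J. profit I i = c}" and ?B = "{i\<in>B. profit I i = c}"
  have "agg I (insert i ?J) = agg I ?J" if i: "i \<in> ?B" for i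
  proof -
    have "agg I (insert i J) = agg I J"
      using agg_mono[of J "insert i J"] agg_mono[of "insert i J" R] i J R B by fastforce
    moreover have "J - {j\<in>J. profit I j \<noteq> c} = ?J" by auto
    ultimately show ?thesis
      using spanned_without_other_profits[of J i "{j\<in>J. profit I j \<noteq> c}"] i J R B by auto
  qed
  then have "agg I (?J \<union> ?B) = agg I ?J"
    using agg_union_spanned[of ?J ?B] J R B by blast
  moreover have "agg I ?B \<le> agg I (?J \<union> ?B)"
    using agg_mono[of ?B "?J \<union> ?B"] J R B by blast
  moreover have "indep I ?J" "indep I ?B"
    using indep_subset[of J ?J] indep_subset[of B ?B] J R B by auto
  moreover have "(\<Sum>i\<in>?J. profit I i) = c * card ?J" "(\<Sum>i\<in>?B. profit I i) = c * card ?B"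
    by auto
  ultimately show ?thesis using c by (simp add: indep_def)
qed

section \<open>Greedy bases and the weight-reducing injection\<close>

lemma greedy_snoc: "greedy I (xs @ [x]) = greedy_step I (greedy I xs) x"
  by (simp add: greedy_def)

text \<open>The greedy set has the same value as the scanned prefix, so submodularity
  (\<open>le\<close>) and monotonicity (\<open>ge\<close>) show that both have the same value after
  the next item joins. Rejecting an item without gain therefore loses nothing.\<close>

lemma greedy_basis:
  assumes "set xs \<subseteq> items I"
  shows "greedy I xs \<subseteq> set xs" "indep I (greedy I xs)" "agg I (greedy I xs) = agg I (set xs)"
proof -
  have "greedy I xs \<subseteq> set xs \<and> indep I (greedy I xs) \<and> agg I (greedy I xs) = agg I (set xs)"
    using assms
  proof (induction xs rule: rev_induct)
    case (snoc x xs)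
    let ?G = "greedy I xs"
    have IH: "?G \<subseteq> set xs" "indep I ?G" "agg I ?G = agg I (set xs)"
      and x: "x \<in> items I" "set xs \<subseteq> items I" using snoc by auto
    have G: "?G \<subseteq> items I" using IH x by auto
    have le: "agg I (insert x (set xs)) \<le> agg I (insert x ?G)"
      using agg_submodular[of x ?G "set xs"] IH x by auto
    have ge: "agg I (insert x ?G) \<le> agg I (insert x (set xs))"
      using agg_mono[of "insert x ?G" "insert x (set xs)"] IH x by auto
    show ?case
    proof (cases "agg I ?G < agg I (insert x ?G)")
      case True
      then have "agg I (insert x ?G) = agg I ?G + profit I x" "x \<notin> ?G"
        using agg_insert_cases[OF x(1) G] by (auto simp: insert_absorb)
      then have "indep I (insert x ?G)"
        using IH finite_sub[OF G] by (simp add: indep_def)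
      with True IH le ge show ?thesis by (auto simp: greedy_snoc greedy_step_def)
    next
      case False
      moreover have "agg I (set xs) \<le> agg I (insert x (set xs))"
        using agg_mono[of "set xs" "insert x (set xs)"] x by auto
      ultimately have "agg I ?G = agg I (insert x (set xs))" using IH le by simp
      with False IH show ?thesis by (auto simp: greedy_snoc greedy_step_def)
    qed
  qed (simp add: greedy_def indep_def agg_empty)
  then show "greedy I xs \<subseteq> set xs" "indep I (greedy I xs)" "agg I (greedy I xs) = agg I (set xs)"
    by auto
qed

text \<open>Induction along the scan: the injection for \<open>B - {x}\<close> is kept, and
  \<open>x\<close> is sent to a free greedy item of the same profit. Any such item has been scanned
  no later than \<open>x\<close>, so it is not heavier.\<close>

lemma greedy_injection:
  assumes "set xs \<subseteq> items I" "sorted (map (weight I) xs)" "indep I B" "B \<subseteq> set xs"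
  shows "\<exists>\<phi>. inj_on \<phi> B \<and> \<phi> ` B \<subseteq> greedy I xs \<and>
    (\<forall>b\<in>B. profit I (\<phi> b) = profit I b \<and> weight I (\<phi> b) \<le> weight I b)"
  using assms
proof (induction xs arbitrary: B rule: rev_induct)
  case (snoc x xs)
  let ?B = "B - {x}" and ?G = "greedy I (xs @ [x])"
  have B: "B \<subseteq> items I" using snoc.prems by blast
  have "indep I ?B" "?B \<subseteq> set xs"
    using indep_subset[OF snoc.prems(3) _ B] snoc.prems(4) by auto
  then obtain \<phi> where \<phi>: "inj_on \<phi> ?B" "\<phi> ` ?B \<subseteq> greedy I xs"
      "\<forall>b\<in>?B. profit I (\<phi> b) = profit I b \<and> weight I (\<phi> b) \<le> weight I b"
    using snoc.IH[of ?B] snoc.prems(1,2) by (auto simp: sorted_append)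
  have sub: "\<phi> ` ?B \<subseteq> ?G" using \<phi>(2) by (auto simp: greedy_snoc greedy_step_def)
  show ?case
  proof (cases "x \<in> B")
    case False
    then show ?thesis using \<phi> sub by (intro exI[of _ \<phi>]) auto
  next
    case True
    let ?c = "profit I x"
    note G = greedy_basis[OF snoc.prems(1)]
    have finB: "finite B" using B finite_sub by blast
    \<comment> \<open>Pigeonhole: the class of \<open>x\<close> in \<open>B - {x}\<close> is
      strictly smaller than the class in the greedy set, so some greedy item of this profit is not
      yet an image.\<close>
    have "card {i\<in>?B. profit I i = ?c} < card {i\<in>B. profit I i = ?c}"
      using True finB by (intro psubset_card_mono) auto
    also have "\<dots> \<le> card {i\<in>?G. profit I i = ?c}"
      using G snoc.prems True B profit_pos[of x]
      by (intro indep_card_class_le[where R = "set (xs @ [x])"]) auto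
    finally have "card (\<phi> ` {i\<in>?B. profit I i = ?c}) < card {i\<in>?G. profit I i = ?c}"
      using card_image_le[of "{i\<in>?B. profit I i = ?c}" \<phi>] finB by auto
    then have "\<not> {i\<in>?G. profit I i = ?c} \<subseteq> \<phi> ` {i\<in>?B. profit I i = ?c}"
      using card_mono[of "\<phi> ` {i\<in>?B. profit I i = ?c}" "{i\<in>?G. profit I i = ?c}"] finB by auto
    then obtain y where y: "y \<in> ?G" "profit I y = ?c" "y \<notin> \<phi> ` {i\<in>?B. profit I i = ?c}"
      by blast
    \<comment> \<open>Items of other profits cannot be mapped to \<open>y\<close> either, because
      \<open>\<phi>\<close> preserves profits.\<close>
    have y': "y \<notin> \<phi> ` ?B" using y \<phi>(3) by force
    have "weight I y \<le> weight I x"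
      using y(1) G(1) snoc.prems(2) by (auto simp: sorted_append)
    moreover have inj: "inj_on (\<phi>(x := y)) B"
      using \<phi>(1) y' by (auto simp: inj_on_def)
    moreover have "(\<phi>(x := y)) ` B \<subseteq> ?G" using sub y by auto
    ultimately show ?thesis
      using \<phi>(3) y(2) by (intro exI[of _ "\<phi>(x := y)"] conjI inj) auto
  qed
qed auto

section \<open>Bases adapted to a chain\<close>

text \<open>A maximal independent set between \<open>A\<close> and \<open>S\<close> spans
  \<open>S\<close>: an item with positive marginal value contributes its full profit, so adding it
  would preserve independence.\<close>

lemma indep_extend:
  assumes "A \<subseteq> S" "S \<subseteq> items I" "indep I A"
  shows "\<exists>B. A \<subseteq> B \<and> B \<subseteq> S \<and> indep I B \<and> agg I B = agg I S"
proof -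
  let ?F = "{B. A \<subseteq> B \<and> B \<subseteq> S \<and> indep I B}"
  have "finite ?F" using finite_sub[OF assms(2)] by auto
  moreover have "A \<in> ?F" using assms by auto
  ultimately obtain B where B: "B \<in> ?F" and max: "\<forall>C\<in>?F. B \<subseteq> C \<longrightarrow> B = C"
    using finite_has_maximal2[of ?F A] by auto
  have Bi: "B \<subseteq> items I" using B assms by auto
  have "agg I (insert i B) = agg I B" if i: "i \<in> S" for i
  proof (rule ccontr)
    assume neq: "agg I (insert i B) \<noteq> agg I B"
    then have "agg I (insert i B) = agg I B + profit I i" "i \<notin> B"
      using agg_insert_cases[of i B] i Bi assms(2) by (auto simp: insert_absorb)
    then have "insert i B \<in> ?F"
      using B i finite_sub[OF Bi] by (auto simp: indep_def)
    then have "B = insert i B" using max by (meson subset_insertI)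
    then show False using \<open>i \<notin> B\<close> by auto
  qed
  then have "agg I (B \<union> S) = agg I B"
    using agg_union_spanned[of B S] Bi assms(2) by auto
  moreover have "B \<union> S = S" using B by auto
  ultimately show ?thesis using B by auto
qed

text \<open>The basis grows along the chain. One set \<open>B\<close> for all times is what keeps
  the images nested when an injection is applied later.\<close>

lemma chain_basis:
  fixes T :: nat
  assumes "\<And>s t. 1 \<le> s \<Longrightarrow> s \<le> t \<Longrightarrow> t \<le> T \<Longrightarrow> S s \<subseteq> S t"
    and "\<And>t. 1 \<le> t \<Longrightarrow> t \<le> T \<Longrightarrow> S t \<subseteq> items I"
  shows "\<exists>B. B \<subseteq> items I \<and> (1 \<le> T \<longrightarrow> B \<subseteq> S T) \<and> (T = 0 \<longrightarrow> B = {}) \<and> indep I B \<and>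
    (\<forall>t\<in>{1..T}. agg I (B \<inter> S t) = agg I (S t))"
  using assms
proof (induction T)
  case 0
  show ?case by (auto simp: indep_def agg_empty)
next
  case (Suc T)
  have "\<exists>B. B \<subseteq> items I \<and> (1 \<le> T \<longrightarrow> B \<subseteq> S T) \<and> (T = 0 \<longrightarrow> B = {}) \<and> indep I B \<and>
    (\<forall>t\<in>{1..T}. agg I (B \<inter> S t) = agg I (S t))"
    by (rule Suc.IH) (use Suc.prems le_SucI in blast)+
  then obtain A where A: "A \<subseteq> items I" "1 \<le> T \<longrightarrow> A \<subseteq> S T" "T = 0 \<longrightarrow> A = {}" "indep I A"
      "\<forall>t\<in>{1..T}. agg I (A \<inter> S t) = agg I (S t)"
    by blast
  \<comment> \<open>For \<open>T = 0\<close> nothing is known about \<open>S 0\<close>; the conjunct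
    forcing \<open>A = {}\<close> covers this case.\<close>
  have "A \<subseteq> S (Suc T)" using A Suc.prems(1)[of T "Suc T"] by (cases T) auto
  moreover have S: "S (Suc T) \<subseteq> items I" using Suc.prems(2)[of "Suc T"] by simp
  ultimately obtain B where B: "A \<subseteq> B" "B \<subseteq> S (Suc T)" "indep I B" "agg I B = agg I (S (Suc T))"
    using indep_extend[OF _ _ A(4), of "S (Suc T)"] by blast
  have eq: "agg I (B \<inter> S t) = agg I (S t)" if t: "t \<in> {1..Suc T}" for t
  proof (cases "t = Suc T")
    case True
    then show ?thesis using B by (simp add: Int_absorb2)
  next
    case False
    have St: "S t \<subseteq> items I" using Suc.prems(2)[of t] t by simp
    have "agg I (A \<inter> S t) = agg I (S t)" using A t False by auto
    \<comment> \<open>Enlarging \<open>A\<close> to \<open>B\<close> does not disturb earlier times,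
      since the value is squeezed between those of \<open>A \<inter> S t\<close> and
      \<open>S t\<close>.\<close>
    moreover have "agg I (A \<inter> S t) \<le> agg I (B \<inter> S t)" "agg I (B \<inter> S t) \<le> agg I (S t)"
      using agg_mono[of "A \<inter> S t" "B \<inter> S t"] agg_mono[of "B \<inter> S t" "S t"] B St by auto
    ultimately show ?thesis by simp
  qed
  show ?case
    using B(2,3) S by (intro exI[of _ B] conjI ballI impI eq) auto
qed

lemma modular_chain_dominates:
  assumes "set xs = items I" "sorted (map (weight I) xs)" "feasible_chain I S"
  shows "\<exists>R. feasible_chain (modularize I (greedy I xs)) R \<and>
    objective (modularize I (greedy I xs)) R = objective I S"
proof -
  note S = assms(3)[unfolded feasible_chain_def]
  obtain B where B: "B \<subseteq> items I" "indep I B"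
      "\<forall>t\<in>{1..horizon I}. agg I (B \<inter> S t) = agg I (S t)"
    using chain_basis[of "horizon I" S] S by auto
  obtain \<phi> where \<phi>: "inj_on \<phi> B" "\<phi> ` B \<subseteq> greedy I xs"
      "\<forall>b\<in>B. profit I (\<phi> b) = profit I b \<and> weight I (\<phi> b) \<le> weight I b"
    using greedy_injection[of xs B] assms B by auto
  define R where "R t = \<phi> ` (B \<inter> S t)" for t
  have inj: "inj_on \<phi> (B \<inter> S t)" for t using \<phi>(1) by (auto simp: inj_on_def)
  have profit: "(\<Sum>i\<in>R t. profit I i) = agg I (S t)" if t: "t \<in> {1..horizon I}" for t
  proof -
    have "(\<Sum>i\<in>R t. profit I i) = (\<Sum>i\<in>B \<inter> S t. profit I i)"
      using \<phi>(3) by (simp add: R_def sum.reindex[OF inj])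
    also have "\<dots> = agg I (B \<inter> S t)"
      using indep_subset[OF B(2), of "B \<inter> S t"] B(1) by (simp add: indep_def)
    finally show ?thesis using B t by auto
  qed
  have "(\<Sum>i\<in>R t. weight I i) \<le> real (capacity I t)" if t: "t \<in> {1..horizon I}" for t
  proof -
    have St: "S t \<subseteq> items I" using S t by blast
    have "(\<Sum>i\<in>R t. weight I i) \<le> (\<Sum>i\<in>B \<inter> S t. weight I i)"
      using \<phi>(3) by (auto simp: R_def sum.reindex[OF inj] intro: sum_mono)
    \<comment> \<open>Discarding the items outside \<open>B\<close> cannot raise the weight, as
      weights are nonnegative.\<close>
    also have "\<dots> \<le> (\<Sum>i\<in>S t. weight I i)"
      using St finite_sub[OF St] weight_nonneg by (intro sum_mono2) auto
    also have "\<dots> \<le> real (capacity I t)" using S t by blast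
    finally show ?thesis .
  qed
  moreover have "R s \<subseteq> R t" if "s \<in> {1..horizon I}" "t \<in> {1..horizon I}" "s \<le> t" for s t
    using S that unfolding R_def by blast
  ultimately have "feasible_chain (modularize I (greedy I xs)) R"
    using \<phi>(2) by (auto simp: feasible_chain_def modularize_def R_def)
  moreover have "objective (modularize I (greedy I xs)) R = objective I S"
    using profit by (simp add: objective_def modularize_def)
  ultimately show ?thesis by blast
qed

end

section \<open>Transfer of approximate solutions\<close>

text \<open>There may be infinitely many feasible chains as functions, because values outside
  \<open>{1..horizon I}\<close> are free, but the objective sees only the restriction to that
  interval. This makes \<open>Max\<close> in \<open>optimum\<close> meaningful.\<close>

lemma finite_objectives:
  assumes "finite (items I)"
  shows "finite {objective I S |S. feasible_chain I S}"
proof -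
  have "{objective I S |S. feasible_chain I S} \<subseteq>
    objective I ` (PiE {1..horizon I} (\<lambda>_. Pow (items I)))"
  proof safe
    fix S assume "feasible_chain I S"
    then have "restrict S {1..horizon I} \<in> (PiE {1..horizon I} (\<lambda>_. Pow (items I)))"
      by (auto simp: feasible_chain_def)
    moreover have "objective I S = objective I (restrict S {1..horizon I})"
      by (simp add: objective_def)
    ultimately show "objective I S \<in> objective I ` (PiE {1..horizon I} (\<lambda>_. Pow (items I)))"
      by blast
  qed
  moreover have "finite (PiE {1..horizon I} (\<lambda>_. Pow (items I)))"
    using assms by (intro finite_PiE) auto
  ultimately show ?thesis by (meson finite_imageI finite_subset)
qed

text \<open>The chain is returned unchanged: its sets lie in the independent greedy set, so both
  instances give it the same value, and the restricted optimum is at least the original one.\<close>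

lemma modular_approx_solution:
  assumes "ik_aon I" "set xs = items I" "sorted (map (weight I) xs)" "0 \<le> \<alpha>"
    and "approx_solution \<alpha> (modularize I (greedy I xs)) S"
  shows "approx_solution \<alpha> I S"
proof -
  let ?J = "greedy I xs"
  note basis = greedy_basis[OF assms(1), of xs]
  have J: "?J \<subseteq> items I" "indep I ?J" using basis assms(2) by auto
  have fin: "finite (items I)" using finite_items[OF assms(1)] .
  have S: "feasible_chain (modularize I ?J) S"
    and val: "\<alpha> * real (optimum (modularize I ?J)) \<le> real (objective (modularize I ?J) S)"
    using assms(5) by (auto simp: approx_solution_def)
  have feas: "feasible_chain I S"
    using S J(1) order_trans[OF _ J(1)] by (simp add: feasible_chain_def modularize_def)
  have "(\<Sum>i\<in>S t. profit I i) = agg I (S t)" if "t \<in> {1..horizon I}" for t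
    using indep_subset[OF assms(1) J(2), of "S t"] J(1) S that
    by (auto simp: feasible_chain_def modularize_def indep_def)
  then have obj: "objective (modularize I ?J) S = objective I S"
    by (simp add: objective_def modularize_def)
  \<comment> \<open>The given chain \<open>S\<close> itself witnesses that the set of objective
    values is nonempty.\<close>
  have "optimum I \<in> {objective I S |S. feasible_chain I S}"
    unfolding optimum_def using finite_objectives[OF fin] feas by (intro Max_in) auto
  then obtain R where "feasible_chain (modularize I ?J) R"
      "objective (modularize I ?J) R = optimum I"
    using modular_chain_dominates[OF assms(1-3)] by force
  moreover have "finite (items (modularize I ?J))"
    using J(1) fin finite_subset by (auto simp: modularize_def)
  ultimately have "optimum I \<le> optimum (modularize I ?J)"
    unfolding optimum_def[of "modularize I ?J"] by (intro Max_ge finite_objectives) force+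
  then have "\<alpha> * real (optimum I) \<le> \<alpha> * real (optimum (modularize I ?J))"
    using assms(4) by (simp add: mult_left_mono)
  with val obj feas show ?thesis by (simp add: approx_solution_def)
qed

section \<open>Weakest preconditions with running time\<close>

text \<open>Total correctness: a halting run is asserted, and its time is passed to the
  postcondition, matching the existential form of \<open>solves_within\<close>.\<close>

definition wp ::
  "('op \<Rightarrow> real \<Rightarrow> real \<Rightarrow> real) \<Rightarrow> (nat set \<rightharpoonup> nat) \<Rightarrow> nat \<Rightarrow> 'op com \<Rightarrow>
   (nat \<Rightarrow> store \<Rightarrow> bool) \<Rightarrow> store \<Rightarrow> bool" where
  "wp prim orc \<tau> c Q s \<longleftrightarrow> (\<exists>k s'. exec prim orc \<tau> c s k s' \<and> Q k s')"

abbreviation seq_syntax :: "'op com \<Rightarrow> 'op com \<Rightarrow> 'op com"  (infixr ";;" 60) where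
  "c ;; d \<equiv> Seq c d"

inductive_simps exec_iff:
  "exec prim orc \<tau> Skip s k s'"
  "exec prim orc \<tau> (Const x m) s k s'"
  "exec prim orc \<tau> (Copy x y) s k s'"
  "exec prim orc \<tau> (Add x y z) s k s'"
  "exec prim orc \<tau> (Load x a y) s k s'"
  "exec prim orc \<tau> (Store a x y) s k s'"
  "exec prim orc \<tau> (Oracle x a) s k s'"
  "exec prim orc \<tau> (c ;; d) s k s'"
  "exec prim orc \<tau> (IfLess x y c d) s k s'"

lemma wp_elementary [simp]:
  "wp prim orc \<tau> Skip Q s = Q 1 s"
  "wp prim orc \<tau> (Const x m) Q s = Q 1 (set_var x (real m) s)"
  "wp prim orc \<tau> (Copy x y) Q s = Q 1 (set_var x (var s y) s)"
  "wp prim orc \<tau> (Add x y z) Q s = Q 1 (set_var x (var s y + var s z) s)"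
  "wp prim orc \<tau> (Load x a y) Q s = (\<exists>i. var s y = real i \<and> Q 1 (set_var x (arr s a i) s))"
  "wp prim orc \<tau> (Store a x y) Q s = (\<exists>i. var s x = real i \<and> Q 1 (set_arr a i (var s y) s))"
  "wp prim orc \<tau> (Oracle x a) Q s =
     (\<exists>v. orc {i. arr s a i \<noteq> 0} = Some v \<and> Q \<tau> (set_var x (real v) s))"
  by (auto simp: wp_def exec_iff)

lemma wp_Seq [simp]:
  "wp prim orc \<tau> (c ;; d) Q s = wp prim orc \<tau> c (\<lambda>k. wp prim orc \<tau> d (\<lambda>l. Q (k + l))) s"
  unfolding wp_def exec_iff by blast

lemma wp_IfLess [simp]:
  "wp prim orc \<tau> (IfLess x y c d) Q s =
    (if var s x < var s y then wp prim orc \<tau> c (\<lambda>k. Q (1 + k)) s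
     else wp prim orc \<tau> d (\<lambda>k. Q (1 + k)) s)"
  unfolding wp_def exec_iff by auto

lemma wp_mono:
  assumes "wp prim orc \<tau> c P s" "\<And>k s'. P k s' \<Longrightarrow> Q k s'"
  shows "wp prim orc \<tau> c Q s"
  using assms unfolding wp_def by blast

lemma var_set_var [simp]: "var (set_var x v s) = (var s)(x := v)"
  and arr_set_var [simp]: "arr (set_var x v s) = arr s"
  and var_set_arr [simp]: "var (set_arr a i v s) = var s"
  and arr_set_arr [simp]: "arr (set_arr a i v s) = (arr s)(a := (arr s a)(i := v))"
  by (simp_all add: set_var_def set_arr_def)

fun written_vars :: "'op com \<Rightarrow> name set" where
  "written_vars (Const x m) = {x}"
| "written_vars (Copy x y) = {x}"
| "written_vars (Add x y z) = {x}"
| "written_vars (Sub x y z) = {x}"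
| "written_vars (Prim f x y z) = {x}"
| "written_vars (Load x a y) = {x}"
| "written_vars (Oracle x a) = {x}"
| "written_vars (c ;; d) = written_vars c \<union> written_vars d"
| "written_vars (IfLess x y c d) = written_vars c \<union> written_vars d"
| "written_vars (WhileLess x y c) = written_vars c"
| "written_vars _ = {}"

fun written_arrs :: "'op com \<Rightarrow> name set" where
  "written_arrs (Store a x y) = {a}"
| "written_arrs (c ;; d) = written_arrs c \<union> written_arrs d"
| "written_arrs (IfLess x y c d) = written_arrs c \<union> written_arrs d"
| "written_arrs (WhileLess x y c) = written_arrs c"
| "written_arrs _ = {}"

text \<open>A syntactic footprint, so that loop invariants and stage specifications need to mention
  only the cells that change.\<close>

definition frame :: "'op com \<Rightarrow> store \<Rightarrow> store \<Rightarrow> bool" where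
  "frame c s s' \<longleftrightarrow> (\<forall>x. x \<notin> written_vars c \<longrightarrow> var s' x = var s x) \<and>
     (\<forall>a. a \<notin> written_arrs c \<longrightarrow> arr s' a = arr s a)"

lemma exec_frame: "exec prim orc \<tau> c s k s' \<Longrightarrow> frame c s s'"
  by (induction rule: exec.induct) (auto simp: frame_def)

lemma wp_frame:
  assumes "wp prim orc \<tau> c P s" "\<And>k s'. P k s' \<Longrightarrow> frame c s s' \<Longrightarrow> Q k s'"
  shows "wp prim orc \<tau> c Q s"
  using assms exec_frame unfolding wp_def by blast

text \<open>The index of \<open>Inv\<close> is a variant that drops by one per round; since
  \<open>step\<close> demands a successor, the guard must be false at index 0. Each round costs at
  most \<open>b\<close> plus one test, and the failing test gives the leading 1. The frame always
  refers to the state before the loop.\<close>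

lemma wp_WhileLess:
  assumes "Inv m s"
    and step: "\<And>m s'. Inv m s' \<Longrightarrow> frame c s s' \<Longrightarrow> var s' x < var s' y \<Longrightarrow>
      \<exists>m'. m = Suc m' \<and> wp prim orc \<tau> c (\<lambda>k s''. k \<le> b \<and> Inv m' s'') s'"
    and exit: "\<And>m' k s'. Inv m' s' \<Longrightarrow> frame c s s' \<Longrightarrow> \<not> var s' x < var s' y \<Longrightarrow>
      k \<le> 1 + m * (b + 1) \<Longrightarrow> Q k s'"
  shows "wp prim orc \<tau> (WhileLess x y c) Q s"
proof -
  have main: "\<exists>k s'' m'. exec prim orc \<tau> (WhileLess x y c) s' k s'' \<and> Inv m' s'' \<and> frame c s s'' \<and>
      \<not> var s'' x < var s'' y \<and> k \<le> 1 + m * (b + 1)" if "Inv m s'" "frame c s s'" for m s'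
    using that
  proof (induction m arbitrary: s')
    case 0
    then have "\<not> var s' x < var s' y" using step by blast
    then show ?case using 0 by (blast intro: exec.WhileFalse le_add1)
  next
    case (Suc m)
    show ?case
    proof (cases "var s' x < var s' y")
      case False
      then show ?thesis using Suc by (blast intro: exec.WhileFalse le_add1)
    next
      case True
      then obtain k s1 where 1: "exec prim orc \<tau> c s' k s1" "k \<le> b" "Inv m s1"
        using step[OF Suc.prems] unfolding wp_def by blast
      then have "frame c s s1" using exec_frame[OF 1(1)] Suc.prems(2) by (simp add: frame_def)
      then obtain l s2 m' where 2: "exec prim orc \<tau> (WhileLess x y c) s1 l s2" "Inv m' s2"
          "frame c s s2" "\<not> var s2 x < var s2 y" "l \<le> 1 + m * (b + 1)"
        using Suc.IH 1(3) by blast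
      have "1 + k + l \<le> 1 + Suc m * (b + 1)" using 1(2) 2(5) by simp
      then show ?thesis using exec.WhileTrue[OF True 1(1) 2(1)] 2 by blast
    qed
  qed
  have "frame c s s" by (simp add: frame_def)
  from main[OF assms(1) this] show ?thesis unfolding wp_def by (blast intro: exit)
qed

text \<open>With the empty oracle every query gets stuck, so a halting run has made none and stays
  valid, with the same time, for any oracle and any query cost.\<close>

lemma exec_without_oracle:
  "exec prim Map.empty \<sigma> c s k s' \<Longrightarrow> exec prim orc \<tau> c s k s'"
  by (induction rule: exec.induct) (blast intro: exec.intros | simp)+

section \<open>Merge sort\<close>

definition array_of :: "nat list \<Rightarrow> nat \<Rightarrow> real" where
  "array_of L i = (if i < length L then real (L ! i) else 0)"

text \<open>\<open>Add\<close> takes only variables, so the constant 1 is supplied in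
  \<open>''one''\<close> throughout.\<close>

definition copy_array :: "name \<Rightarrow> name \<Rightarrow> 'op com" where
  "copy_array a b = Const ''k'' 0 ;;
     WhileLess ''k'' ''n'' (Load ''x'' a ''k'' ;; Store b ''k'' ''x'' ;; Add ''k'' ''k'' ''one'')"

lemma wp_copy_array:
  assumes "a \<noteq> b" "var s ''n'' = real n" "var s ''one'' = 1"
  shows "wp prim orc \<tau> (copy_array a b) (\<lambda>t s'. t \<le> 2 + 4 * n \<and>
    arr s' b = (\<lambda>i. if i < n then arr s a i else arr s b i)) s"
  unfolding copy_array_def wp_Seq wp_elementary
proof (rule wp_WhileLess[where b = 3 and m = n and Inv = "\<lambda>m s'. \<exists>j\<le>n. m = n - j \<and>
      var s' ''k'' = real j \<and> arr s' b = (\<lambda>i. if i < j then arr s a i else arr s b i)"], goal_cases)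
  case 1
  show ?case using assms by auto
next
  case (2 m s')
  then obtain j where j: "j \<le> n" "m = n - j" "var s' ''k'' = real j"
    "arr s' b = (\<lambda>i. if i < j then arr s a i else arr s b i)" by blast
  have fr: "var s' ''n'' = real n" "var s' ''one'' = 1" "arr s' a = arr s a"
    using 2(2) assms by (auto simp: frame_def)
  have "j < n" using 2(3) j fr by simp
  then show ?case
    using assms(1) j fr
    by (intro exI[of _ "n - Suc j"]) (auto intro!: exI[of _ "Suc j"] simp: less_Suc_eq)
next
  case (3 m' k s')
  have "var s' ''n'' = real n" using 3(2) assms by (auto simp: frame_def)
  then show ?case using 3(1,3,4) by auto
qed

section \<open>Merging and merge passes on lists\<close>

text \<open>Ties go to the left list, as in the test of \<open>merge_step\<close>, so that the
  program computes this very list.\<close>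

fun merge_by :: "('a \<Rightarrow> real) \<Rightarrow> 'a list \<Rightarrow> 'a list \<Rightarrow> 'a list" where
  "merge_by f [] ys = ys"
| "merge_by f xs [] = xs"
| "merge_by f (x # xs) (y # ys) =
     (if f y < f x then y # merge_by f (x # xs) ys else x # merge_by f xs (y # ys))"

lemma merge_by_Nil2 [simp]: "merge_by f xs [] = xs"
  by (cases xs) auto

lemma mset_merge_by [simp]: "mset (merge_by f xs ys) = mset xs + mset ys"
  by (induction f xs ys rule: merge_by.induct) auto

lemma set_merge_by [simp]: "set (merge_by f xs ys) = set xs \<union> set ys"
  using mset_merge_by[of f xs ys] by (metis set_mset_mset set_mset_union)

lemma length_merge_by [simp]: "length (merge_by f xs ys) = length xs + length ys"
  using mset_merge_by[of f xs ys] by (metis size_mset size_union)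

lemma sorted_merge_by:
  "sorted (map f xs) \<Longrightarrow> sorted (map f ys) \<Longrightarrow> sorted (map f (merge_by f xs ys))"
  by (induction f xs ys rule: merge_by.induct) fastforce+

text \<open>One level of bottom-up merge sort with runs of length \<open>w\<close>. The case
  \<open>w = 0\<close> is cut off because the recursion would not shorten the list.\<close>

function merge_pass :: "('a \<Rightarrow> real) \<Rightarrow> nat \<Rightarrow> 'a list \<Rightarrow> 'a list" where
  "merge_pass f w xs = (if xs = [] \<or> w = 0 then xs
     else merge_by f (take w xs) (take w (drop w xs)) @ merge_pass f w (drop (2 * w) xs))"
  by auto
termination by (relation "measure (\<lambda>(f, w, xs). length xs)") auto

declare merge_pass.simps [simp del]

lemma merge_pass_Nil [simp]: "merge_pass f w [] = []"
  by (simp add: merge_pass.simps)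

lemma mset_merge_pass [simp]: "mset (merge_pass f w xs) = mset xs"
proof (induction f w xs rule: merge_pass.induct)
  case (1 f w xs)
  have "mset xs = mset (take w xs) + mset (take w (drop w xs)) + mset (drop (2 * w) xs)"
    by (metis add.assoc append_take_drop_id drop_drop mset_append mult_2)
  then show ?case using 1 by (subst merge_pass.simps) auto
qed

lemma length_merge_pass [simp]: "length (merge_pass f w xs) = length xs"
  by (metis mset_merge_pass size_mset)

definition sorted_blocks :: "('a \<Rightarrow> real) \<Rightarrow> nat \<Rightarrow> 'a list \<Rightarrow> bool" where
  "sorted_blocks f w xs \<longleftrightarrow> (\<forall>k. sorted (map f (take w (drop (k * w) xs))))"

text \<open>If fewer than \<open>2 * w\<close> items remain, the result is one merged run and each
  of its slices is sorted. Otherwise the merged run has length exactly \<open>2 * w\<close>, so the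
  later blocks are aligned with those of the recursive result.\<close>

lemma sorted_blocks_merge_pass:
  "0 < w \<Longrightarrow> sorted_blocks f w xs \<Longrightarrow> sorted_blocks f (2 * w) (merge_pass f w xs)"
proof (induction f w xs rule: merge_pass.induct)
  case (1 f w xs)
  show ?case
  proof (cases "xs = []")
    case True
    then show ?thesis by (simp add: sorted_blocks_def)
  next
    case False
    let ?m = "merge_by f (take w xs) (take w (drop w xs))"
      and ?r = "merge_pass f w (drop (2 * w) xs)"
    have blocks: "sorted (map f (take w (drop (k * w) xs)))" for k
      using "1.prems" by (auto simp: sorted_blocks_def)
    have eq: "merge_pass f w xs = ?m @ ?r" using False "1.prems" by (subst merge_pass.simps) simp
    have m: "sorted (map f ?m)"
      using sorted_merge_by[of f "take w xs" "take w (drop w xs)"] blocks[of 0] blocks[of 1] by simp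
    have "sorted_blocks f w (drop (2 * w) xs)"
      unfolding sorted_blocks_def
    proof
      fix k
      show "sorted (map f (take w (drop (k * w) (drop (2 * w) xs))))"
        using blocks[of "k + 2"] by (simp only: drop_drop add_mult_distrib)
    qed
    then have r: "sorted_blocks f (2 * w) ?r" using 1 False by auto
    have "sorted (map f (take (2 * w) (drop (k * (2 * w)) (?m @ ?r))))" for k
    proof (cases "length xs < 2 * w")
      case True
      then have "?r = []" by simp
      moreover have "sorted (map f (take i (drop j ?m)))" for i j
        using m by (simp add: sorted_wrt_take sorted_wrt_drop flip: take_map drop_map)
      ultimately show ?thesis by (metis append_Nil2)
    next
      case False
      then have len: "length ?m = 2 * w" by simp
      show ?thesis
      proof (cases k)
        case 0
        then show ?thesis using m len by simp
      next
        case (Suc l)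
        then have "drop (k * (2 * w)) (?m @ ?r) = drop (l * (2 * w)) ?r"
          using len by simp
        then show ?thesis using r by (simp add: sorted_blocks_def)
      qed
    qed
    then show ?thesis unfolding eq sorted_blocks_def by blast
  qed
qed

section \<open>The merge pass as a program\<close>

text \<open>The conditionals compute minima with \<open>''n''\<close>, which clip an incomplete last
  block.\<close>

definition open_block :: "'op com" where
  "open_block =
     Copy ''i'' ''k'' ;; Add ''mid'' ''k'' ''wd'' ;; IfLess ''n'' ''mid'' (Copy ''mid'' ''n'') Skip ;;
     Copy ''j'' ''mid'' ;; Add ''hi'' ''mid'' ''wd'' ;; IfLess ''n'' ''hi'' (Copy ''hi'' ''n'') Skip"

definition take_left :: "'op com" where
  "take_left = Load ''x'' ''a'' ''i'' ;; Store ''b'' ''k'' ''x'' ;; Add ''i'' ''i'' ''one''"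

definition take_right :: "'op com" where
  "take_right = Load ''x'' ''a'' ''j'' ;; Store ''b'' ''k'' ''x'' ;; Add ''j'' ''j'' ''one''"

definition merge_step :: "'op com" where
  "merge_step =
     IfLess ''i'' ''mid''
       (IfLess ''j'' ''hi''
          (Load ''x'' ''a'' ''i'' ;; Load ''wx'' ''w'' ''x'' ;;
           Load ''y'' ''a'' ''j'' ;; Load ''wy'' ''w'' ''y'' ;;
           IfLess ''wy'' ''wx'' take_right take_left)
          take_left)
       take_right"

text \<open>A single loop over the output position replaces nested loops over blocks: every round
  writes one cell, so linear time is immediate. The initial zeros describe an exhausted block, which
  makes the first round open a new one.\<close>

definition merge_pass_com :: "'op com" where
  "merge_pass_com =
     Const ''k'' 0 ;; Const ''i'' 0 ;; Const ''mid'' 0 ;; Const ''j'' 0 ;; Const ''hi'' 0 ;;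
     WhileLess ''k'' ''n''
       (IfLess ''k'' ''hi'' Skip open_block ;; merge_step ;; Add ''k'' ''k'' ''one'')"

text \<open>The intervals \<open>{i..<mid}\<close> and \<open>{j..<hi}\<close> of \<open>a\<close> are the unread parts of the two halves of the
  current block, which ends at \<open>hi\<close>; the next write goes to cell \<open>k\<close> of \<open>b\<close>.\<close>

definition merge_inv ::
  "(nat \<Rightarrow> real) \<Rightarrow> nat \<Rightarrow> nat list \<Rightarrow> nat \<Rightarrow> nat \<Rightarrow> nat \<Rightarrow> nat \<Rightarrow> nat \<Rightarrow> store \<Rightarrow> bool" where
  "merge_inv f w L k i mid j hi s \<longleftrightarrow>
     var s ''n'' = real (length L) \<and> var s ''one'' = 1 \<and> var s ''wd'' = real w \<and>
     var s ''k'' = real k \<and> var s ''i'' = real i \<and> var s ''mid'' = real mid \<and>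
     var s ''j'' = real j \<and> var s ''hi'' = real hi \<and>
     arr s ''a'' = array_of L \<and> arr s ''w'' = f \<and>
     (\<forall>l<k. arr s ''b'' l = real (merge_pass f w L ! l)) \<and>
     (\<forall>l\<ge>length L. arr s ''b'' l = 0) \<and>
     i \<le> mid \<and> mid \<le> j \<and> j \<le> hi \<and> hi \<le> length L \<and> k + (mid - i) + (hi - j) = hi \<and>
     drop k (merge_pass f w L) =
       merge_by f (take (mid - i) (drop i L)) (take (hi - j) (drop j L)) @
       merge_pass f w (drop hi L)"

lemma wp_open_block:
  assumes "merge_inv f w L k i mid j hi s" "k < length L" "0 < w"
  shows "wp prim orc \<tau> (IfLess ''k'' ''hi'' Skip open_block) (\<lambda>t s'. t \<le> 9 \<and>
    (\<exists>i mid j hi. merge_inv f w L k i mid j hi s' \<and> k < hi)) s"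
proof (cases "k < hi")
  case True
  then show ?thesis using assms(1) by (auto simp: merge_inv_def)
next
  case False
  note inv = assms(1)[unfolded merge_inv_def]
  \<comment> \<open>The counting equation of the invariant leaves no unread items once
    \<open>k\<close> has reached \<open>hi\<close>, so the recursion equation of
    \<open>merge_pass\<close> can be unfolded at \<open>k\<close>.\<close>
  have eq: "hi = k" "mid = i" "j = hi" using False inv by auto
  let ?n = "length L"
  define m where "m = min (k + w) ?n"
  define h where "h = min (m + w) ?n"
  have h_eq: "h = min (k + 2 * w) ?n" by (auto simp: m_def h_def)
  have "drop k (merge_pass f w L) = merge_pass f w (drop k L)"
    using inv eq by simp
  also have "\<dots> = merge_by f (take w (drop k L)) (take w (drop w (drop k L))) @
      merge_pass f w (drop (2 * w) (drop k L))"
    using assms(2,3) by (subst merge_pass.simps) simp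
  also have "take w (drop k L) = take (m - k) (drop k L)"
    by (auto simp: m_def min_def)
  also have "take w (drop w (drop k L)) = take (h - m) (drop m L)"
    by (auto simp: m_def h_def min_def add.commute)
  also have "drop (2 * w) (drop k L) = drop h L"
    by (auto simp: h_eq min_def add.commute)
  finally have drop: "drop k (merge_pass f w L) =
      merge_by f (take (m - k) (drop k L)) (take (h - m) (drop m L)) @ merge_pass f w (drop h L)" .
  have bounds: "k \<le> m" "m \<le> h" "h \<le> ?n" "k < h"
    using assms(2,3) by (auto simp: m_def h_def)
  have inv': "merge_inv f w L k k m m h s'"
    if "var s' = (var s)(''i'' := real k, ''mid'' := real m, ''j'' := real m, ''hi'' := real h)"
      "arr s' = arr s" for s'
    unfolding merge_inv_def using that inv drop bounds by simp
  have m: "real m = (if real ?n < real k + real w then real ?n else real k + real w)"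
    by (auto simp: m_def min_def)
  have h: "real h = (if real ?n < real m + real w then real ?n else real m + real w)"
    by (auto simp: h_def min_def)
  have vars: "var s ''n'' = real ?n" "var s ''wd'' = real w" "var s ''k'' = real k"
      "\<not> var s ''k'' < var s ''hi''"
    using inv eq by auto
  have "wp prim orc \<tau> (IfLess ''k'' ''hi'' Skip open_block) (\<lambda>t s'. t \<le> 9 \<and>
      var s' = (var s)(''i'' := real k, ''mid'' := real m, ''j'' := real m, ''hi'' := real h) \<and>
      arr s' = arr s) s"
    unfolding open_block_def using vars m h by (auto simp: fun_eq_iff)
  then show ?thesis
    by (rule wp_mono) (use inv' bounds in blast)
qed

lemma wp_merge_step:
  assumes "merge_inv f w L k i mid j hi s" "k < hi"
  shows "wp prim orc \<tau> (merge_step ;; Add ''k'' ''k'' ''one'') (\<lambda>t s'. t \<le> 11 \<and>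
    (\<exists>i mid j hi. merge_inv f w L (Suc k) i mid j hi s')) s"
proof -
  note inv = assms(1)[unfolded merge_inv_def]
  let ?M = "merge_pass f w L"
  have k: "k < length ?M" using assms inv by simp
  have drop: "?M ! k = x" "drop (Suc k) ?M = r" if "drop k ?M = x # r" for x r
    using that k by (metis Cons_nth_drop_Suc list.inject)+
  have left: "take (mid - i) (drop i L) = L ! i # take (mid - Suc i) (drop (Suc i) L)" if "i < mid"
    using that inv by (metis Cons_nth_drop_Suc Suc_diff_Suc less_le_trans take_Suc_Cons order_trans)
  have right: "take (hi - j) (drop j L) = L ! j # take (hi - Suc j) (drop (Suc j) L)" if "j < hi"
    using that inv by (metis Cons_nth_drop_Suc Suc_diff_Suc less_le_trans take_Suc_Cons)
  \<comment> \<open>Stated for every state satisfying the invariant, because the comparing branch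
    has already overwritten \<open>''x''\<close>, \<open>''y''\<close>, \<open>''wx''\<close> and
    \<open>''wy''\<close>. The advance of \<open>''k''\<close> is built into the postcondition, as
    the invariant fails between the write and the increment.\<close>
  have L: "wp prim orc \<tau> take_left (\<lambda>t s'. t = 3 \<and> merge_inv f w L (Suc k) (Suc i) mid j hi
      (set_var ''k'' (real (Suc k)) s')) s'"
    if "i < mid" "j < hi \<Longrightarrow> \<not> f (L ! j) < f (L ! i)"
      "merge_inv f w L k i mid j hi s'" for s'
  proof -
    note inv' = that(3)[unfolded merge_inv_def]
    have "drop k ?M = L ! i # (merge_by f (take (mid - Suc i) (drop (Suc i) L))
        (take (hi - j) (drop j L)) @ merge_pass f w (drop hi L))"
    proof (cases "j < hi")
      case True
      then show ?thesis using inv left[OF that(1)] right that(2) by simp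
    next
      case False
      then show ?thesis using inv left[OF that(1)] by simp
    qed
    note d = drop[OF this]
    have "array_of L i = real (L ! i)" using inv that(1) by (simp add: array_of_def)
    then show ?thesis
      unfolding take_left_def merge_inv_def using inv' that(1) d k by (auto simp: less_Suc_eq)
  qed
  have R: "wp prim orc \<tau> take_right (\<lambda>t s'. t = 3 \<and> merge_inv f w L (Suc k) i mid (Suc j) hi
      (set_var ''k'' (real (Suc k)) s')) s'"
    if "j < hi" "i < mid \<Longrightarrow> f (L ! j) < f (L ! i)"
      "merge_inv f w L k i mid j hi s'" for s'
  proof -
    note inv' = that(3)[unfolded merge_inv_def]
    have "drop k ?M = L ! j # (merge_by f (take (mid - i) (drop i L))
        (take (hi - Suc j) (drop (Suc j) L)) @ merge_pass f w (drop hi L))"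
    proof (cases "i < mid")
      case True
      then show ?thesis using inv right[OF that(1)] left that(2) by simp
    next
      case False
      then show ?thesis using inv right[OF that(1)] by simp
    qed
    note d = drop[OF this]
    have "array_of L j = real (L ! j)" using inv that(1) by (simp add: array_of_def)
    then show ?thesis
      unfolding take_right_def merge_inv_def using inv' that(1) d k by (auto simp: less_Suc_eq)
  qed
  have "wp prim orc \<tau> merge_step (\<lambda>t s'. t \<le> 10 \<and>
    (\<exists>i mid j hi. merge_inv f w L (Suc k) i mid j hi (set_var ''k'' (real (Suc k)) s'))) s"
  proof (cases "i < mid")
    case False
    then have "j < hi" using inv assms(2) by auto
    from R[OF this _ assms(1)] False have "wp prim orc \<tau> take_right
      (\<lambda>t s'. t = 3 \<and> merge_inv f w L (Suc k) i mid (Suc j) hi (set_var ''k'' (real (Suc k)) s')) s"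
      by blast
    then have "wp prim orc \<tau> take_right (\<lambda>t s'. Suc t \<le> 10 \<and>
      (\<exists>i mid j hi. merge_inv f w L (Suc k) i mid j hi (set_var ''k'' (real (Suc k)) s'))) s"
      by (rule wp_mono) auto
    then show ?thesis using False inv by (simp add: merge_step_def)
  next
    case True
    show ?thesis
    proof (cases "j < hi")
      case False
      from L[OF True _ assms(1)] False have "wp prim orc \<tau> take_left
        (\<lambda>t s'. t = 3 \<and> merge_inv f w L (Suc k) (Suc i) mid j hi (set_var ''k'' (real (Suc k)) s')) s"
        by blast
      then have "wp prim orc \<tau> take_left (\<lambda>t s'. Suc (Suc t) \<le> 10 \<and>
        (\<exists>i mid j hi. merge_inv f w L (Suc k) i mid j hi (set_var ''k'' (real (Suc k)) s'))) s"
        by (rule wp_mono) auto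
      then show ?thesis using True False inv by (simp add: merge_step_def)
    next
      case j: True
      define s' where "s' = set_var ''wy'' (f (L ! j)) (set_var ''y'' (real (L ! j))
        (set_var ''wx'' (f (L ! i)) (set_var ''x'' (real (L ! i)) s)))"
      have s': "merge_inv f w L k i mid j hi s'"
        unfolding merge_inv_def s'_def using inv by auto
      have "array_of L i = real (L ! i)" "array_of L j = real (L ! j)"
        using inv True j by (simp_all add: array_of_def)
      \<comment> \<open>The 7 consists of two range tests, four loads and the weight
        comparison.\<close>
      then have red: "wp prim orc \<tau> merge_step Q s =
          (if f (L ! j) < f (L ! i) then wp prim orc \<tau> take_right (\<lambda>t. Q (t + 7)) s'
           else wp prim orc \<tau> take_left (\<lambda>t. Q (t + 7)) s')" for Q
        using True j inv by (simp add: merge_step_def s'_def numeral_eq_Suc)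
      show ?thesis
      proof (cases "f (L ! j) < f (L ! i)")
        case less: True
        show ?thesis unfolding red using less
          by (simp, intro wp_mono[OF R[OF j less s']]) auto
      next
        case less: False
        show ?thesis unfolding red using less
          by (simp, intro wp_mono[OF L[OF True less s']]) auto
      qed
    qed
  qed
  \<comment> \<open>No branch writes \<open>''k''\<close> or \<open>''one''\<close>, so the
    subsequent addition yields exactly \<open>Suc k\<close>.\<close>
  moreover have "wp prim orc \<tau> merge_step (\<lambda>t s'. P t s' \<and> var s' ''k'' = real k \<and> var s' ''one'' = 1) s"
    if "wp prim orc \<tau> merge_step P s" for P
    using that
    by (rule wp_frame)
      (use inv in \<open>auto simp: frame_def merge_step_def take_left_def take_right_def\<close>)
  ultimately have "wp prim orc \<tau> merge_step (\<lambda>t s'. (t \<le> 10 \<and>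
    (\<exists>i mid j hi. merge_inv f w L (Suc k) i mid j hi (set_var ''k'' (real (Suc k)) s'))) \<and>
    var s' ''k'' = real k \<and> var s' ''one'' = 1) s"
    by blast
  then show ?thesis unfolding wp_Seq
    by (rule wp_mono) (auto simp: add.commute)
qed

lemma wp_merge_pass_com:
  assumes "var s ''n'' = real (length L)" "var s ''one'' = 1" "var s ''wd'' = real w" "0 < w"
    and "arr s ''a'' = array_of L" "\<forall>l\<ge>length L. arr s ''b'' l = 0"
  shows "wp prim orc \<tau> merge_pass_com (\<lambda>t s'. t \<le> 6 + 21 * length L \<and>
    arr s' ''b'' = array_of (merge_pass (arr s ''w'') w L)) s"
  unfolding merge_pass_com_def wp_Seq wp_elementary
\<comment> \<open>A round costs at most 9 for opening a block (including the test) and 11 for the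
  merge step with its increment.\<close>
proof (rule wp_WhileLess[where b = 20 and m = "length L" and Inv = "\<lambda>m s'. \<exists>k i mid j hi.
      m = length L - k \<and> merge_inv (arr s ''w'') w L k i mid j hi s'"], goal_cases)
  case 1
  show ?case using assms
    by (intro exI[of _ 0]) (auto simp: merge_inv_def)
next
  case (2 m s')
  let ?f = "arr s ''w''"
  obtain k i mid j hi where k: "m = length L - k" "merge_inv ?f w L k i mid j hi s'"
    using 2(1) by blast
  have less: "k < length L" using 2(3) k(2) by (simp add: merge_inv_def)
  have "wp prim orc \<tau> (merge_step ;; Add ''k'' ''k'' ''one'') (\<lambda>u s'. t + u \<le> 20 \<and>
      (\<exists>l i mid j hi. length L - Suc k = length L - l \<and> merge_inv ?f w L l i mid j hi s')) s1"
    if s1: "t \<le> 9 \<and> (\<exists>i mid j hi. merge_inv ?f w L k i mid j hi s1 \<and> k < hi)" for t s1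
  proof -
    obtain i mid j hi where "merge_inv ?f w L k i mid j hi s1" "k < hi" using s1 by blast
    from wp_merge_step[OF this] show ?thesis by (rule wp_mono) (use s1 in fastforce)
  qed
  then have "wp prim orc \<tau> (IfLess ''k'' ''hi'' Skip open_block ;; merge_step ;; Add ''k'' ''k'' ''one'')
      (\<lambda>u s'. u \<le> 20 \<and> (\<exists>l i mid j hi. length L - Suc k = length L - l \<and>
         merge_inv ?f w L l i mid j hi s')) s'"
    unfolding wp_Seq[of _ _ _ "IfLess _ _ _ _"]
    by (intro wp_mono[OF wp_open_block[OF k(2) less assms(4)]]) blast
  moreover have "m = Suc (length L - Suc k)" using less k(1) by simp
  ultimately show ?case by blast
next
  case (3 m' t s')
  then obtain k i mid j hi where inv: "merge_inv (arr s ''w'') w L k i mid j hi s'" by auto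
  then have "length L \<le> k" "k \<le> length L" using 3(3) by (auto simp: merge_inv_def)
  then have "arr s' ''b'' = array_of (merge_pass (arr s ''w'') w L)"
    using inv by (auto simp: merge_inv_def array_of_def fun_eq_iff)
  then show ?case using 3(4) by simp
qed

definition sort_com :: "'op com" where
  "sort_com = Const ''wd'' 1 ;;
     WhileLess ''wd'' ''n'' (merge_pass_com ;; copy_array ''b'' ''a'' ;; Add ''wd'' ''wd'' ''wd'')"

lemmas com_defs = sort_com_def merge_pass_com_def copy_array_def open_block_def merge_step_def
  take_left_def take_right_def

text \<open>The variant is an exponent \<open>m\<close> with
  \<open>length L \<le> w * 2 ^ m\<close>: doubling \<open>w\<close> lowers it by one, and
  \<open>w < length L\<close> excludes \<open>m = 0\<close>. With n for \<open>length L\<close>, a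
  round costs 6 + 21n for the pass, 2 + 4n for copying back, 1 for doubling and 1 for the
  test.\<close>

lemma wp_sort_com:
  assumes n: "var s ''n'' = real (length L)" "var s ''one'' = 1"
    and "arr s ''a'' = array_of L" "\<forall>l\<ge>length L. arr s ''b'' l = 0" "length L \<le> 2 ^ M"
  shows "wp prim orc \<tau> sort_com (\<lambda>t s'. t \<le> 2 + M * (10 + 25 * length L) \<and>
    (\<exists>L'. arr s' ''a'' = array_of L' \<and> mset L' = mset L \<and> sorted (map (arr s ''w'') L') \<and>
      (\<forall>l\<ge>length L. arr s' ''b'' l = 0))) s"
  unfolding sort_com_def wp_Seq[of _ _ _ "Const _ _"] wp_elementary
proof (rule wp_WhileLess[where b = "9 + 25 * length L" and m = M and Inv = "\<lambda>m s'. \<exists>w L'.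
      var s' ''wd'' = real w \<and> 0 < w \<and> length L \<le> w * 2 ^ m \<and> arr s' ''a'' = array_of L' \<and>
      mset L' = mset L \<and> sorted_blocks (arr s ''w'') w L' \<and> (\<forall>l\<ge>length L. arr s' ''b'' l = 0)"],
      goal_cases)
  case 1
  have "sorted_blocks (arr s ''w'') 1 L"
    unfolding sorted_blocks_def
  proof
    fix k
    show "sorted (map (arr s ''w'') (take 1 (drop (k * 1) L)))"
      by (cases "drop (k * 1) L") auto
  qed
  then show ?case using assms by (intro exI[of _ 1] exI[of _ L]) auto
next
  case (2 m s')
  let ?n = "length L" and ?f = "arr s ''w''"
  obtain w L' where w: "var s' ''wd'' = real w" "0 < w" "?n \<le> w * 2 ^ m" "arr s' ''a'' = array_of L'"
      "mset L' = mset L" "sorted_blocks ?f w L'" "\<forall>l\<ge>?n. arr s' ''b'' l = 0"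
    using 2(1) by blast
  have len: "length L' = ?n" using w(5) by (metis size_mset)
  have fr: "var s' ''n'' = real ?n" "var s' ''one'' = 1" "arr s' ''w'' = ?f"
    using 2(2) n by (auto simp: frame_def com_defs)
  have "w < ?n" using 2(3) w(1) fr by simp
  then obtain m' where m: "m = Suc m'" using w(3) by (cases m) auto
  let ?M = "merge_pass ?f w L'"
  have M: "mset ?M = mset L" "length ?M = ?n" "sorted_blocks ?f (2 * w) ?M"
    using w len sorted_blocks_merge_pass by auto
  let ?Q = "\<lambda>k s''. k \<le> 9 + 25 * ?n \<and> (\<exists>w L'. var s'' ''wd'' = real w \<and> 0 < w \<and>
      ?n \<le> w * 2 ^ m' \<and> arr s'' ''a'' = array_of L' \<and> mset L' = mset L \<and>
      sorted_blocks ?f w L' \<and> (\<forall>l\<ge>?n. arr s'' ''b'' l = 0))"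
  have "wp prim orc \<tau> merge_pass_com (\<lambda>k s1. k \<le> 6 + 21 * ?n \<and> arr s1 ''b'' = array_of ?M) s'"
    using wp_merge_pass_com[of s' L' w prim orc \<tau>] fr w len by simp
  then have "wp prim orc \<tau> merge_pass_com (\<lambda>k. wp prim orc \<tau>
      (copy_array ''b'' ''a'' ;; Add ''wd'' ''wd'' ''wd'') (\<lambda>l. ?Q (k + l))) s'"
  proof (rule wp_frame)
    fix k s1
    assume k: "k \<le> 6 + 21 * ?n \<and> arr s1 ''b'' = array_of ?M"
      and "frame (merge_pass_com :: 'a com) s' s1"
    then have fr1: "var s1 ''n'' = real ?n" "var s1 ''one'' = 1" "var s1 ''wd'' = real w"
        "arr s1 ''a'' = array_of L'"
      using fr w by (auto simp: frame_def com_defs)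
    have "wp prim orc \<tau> (copy_array ''b'' ''a'') (\<lambda>l s2. l \<le> 2 + 4 * ?n \<and>
        arr s2 ''a'' = (\<lambda>i. if i < ?n then arr s1 ''b'' i else arr s1 ''a'' i)) s1"
      using fr1 by (intro wp_copy_array) auto
    then have "wp prim orc \<tau> (copy_array ''b'' ''a'')
        (\<lambda>l. wp prim orc \<tau> (Add ''wd'' ''wd'' ''wd'') (\<lambda>l'. ?Q (k + (l + l')))) s1"
    proof (rule wp_frame)
      fix l s2
      assume l: "l \<le> 2 + 4 * ?n \<and>
          arr s2 ''a'' = (\<lambda>i. if i < ?n then arr s1 ''b'' i else arr s1 ''a'' i)"
        and "frame (copy_array ''b'' ''a'' :: 'a com) s1 s2"
      then have fr2: "var s2 ''wd'' = real w" "arr s2 ''b'' = array_of ?M"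
        using fr1 k by (auto simp: frame_def com_defs)
      have "arr s2 ''a'' = array_of ?M"
        using l k fr1 len by (auto simp: array_of_def fun_eq_iff)
      moreover have "?n \<le> 2 * w * 2 ^ m'" using w(3) m by (simp add: ac_simps)
      ultimately show "wp prim orc \<tau> (Add ''wd'' ''wd'' ''wd'') (\<lambda>l'. ?Q (k + (l + l'))) s2"
        using k l fr2 M w(2) by (auto intro!: exI[of _ "2 * w"] exI[of _ ?M] simp: array_of_def)
    qed
    then show "wp prim orc \<tau> (copy_array ''b'' ''a'' ;; Add ''wd'' ''wd'' ''wd'') (\<lambda>l. ?Q (k + l)) s1"
      unfolding wp_Seq .
  qed
  then have "wp prim orc \<tau> (merge_pass_com ;; copy_array ''b'' ''a'' ;; Add ''wd'' ''wd'' ''wd'') ?Q s'"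
    unfolding wp_Seq[of _ _ _ merge_pass_com] .
  then show ?case using m by blast
next
  case (3 m' k s')
  let ?f = "arr s ''w''"
  obtain w L' where w: "var s' ''wd'' = real w" "arr s' ''a'' = array_of L'" "mset L' = mset L"
      "sorted_blocks ?f w L'" "\<forall>l\<ge>length L. arr s' ''b'' l = 0"
    using 3(1) by blast
  have "var s' ''n'' = real (length L)" using 3(2) n by (auto simp: frame_def com_defs)
  then have "length L' \<le> w" using 3(3) w(1) mset_eq_length[OF w(3)] by simp
  \<comment> \<open>Once the width reaches the length, block 0 is the whole list.\<close>
  then have "sorted (map ?f L')" using w(4)[unfolded sorted_blocks_def, rule_format, of 0] by simp
  then show ?case using w(2,3,5) 3(4) by auto
qed

section \<open>Greedy selection and clean-up\<close>

text \<open>The item is inserted tentatively into the query array and removed again if the value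
  does not rise above \<open>''cur''\<close>; this costs one query per item.\<close>

definition greedy_com :: "'op com" where
  "greedy_com = Const ''k'' 0 ;; Const ''cur'' 0 ;; Const ''z'' 0 ;;
     WhileLess ''k'' ''n''
       (Load ''x'' ''a'' ''k'' ;; Store ''in'' ''x'' ''one'' ;; Oracle ''v'' ''in'' ;;
        IfLess ''cur'' ''v'' (Copy ''cur'' ''v'') (Store ''in'' ''x'' ''z'') ;;
        Add ''k'' ''k'' ''one'')"

lemma wp_greedy_com:
  assumes I: "ik_aon I" and n: "var s ''n'' = real (length L)" "var s ''one'' = 1"
    and L: "arr s ''a'' = array_of L" "distinct L" "set L \<subseteq> items I" and "arr s ''in'' = (\<lambda>_. 0)"
  shows "wp prim (agg_oracle I) \<tau> greedy_com (\<lambda>t s'. t \<le> 4 + length L * (6 + \<tau>) \<and>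
    arr s' ''in'' = (\<lambda>i. if i \<in> greedy I L then 1 else 0)) s"
  unfolding greedy_com_def wp_Seq[of _ _ _ "Const _ _"] wp_elementary
proof (rule wp_WhileLess[where b = "5 + \<tau>" and m = "length L" and Inv = "\<lambda>m s'. \<exists>j\<le>length L.
      m = length L - j \<and> var s' ''k'' = real j \<and> var s' ''cur'' = real (agg I (greedy I (take j L))) \<and>
      arr s' ''in'' = (\<lambda>i. if i \<in> greedy I (take j L) then 1 else 0)"], goal_cases)
  case 1
  show ?case using assms agg_empty[OF I] by (auto simp: greedy_def)
next
  case (2 m s')
  then obtain j where j: "m = length L - j" "var s' ''k'' = real j"
      "var s' ''cur'' = real (agg I (greedy I (take j L)))"
      "arr s' ''in'' = (\<lambda>i. if i \<in> greedy I (take j L) then 1 else 0)"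
    by blast
  let ?G = "greedy I (take j L)" and ?x = "L ! j"
  have fr: "var s' ''n'' = real (length L)" "var s' ''one'' = 1" "var s' ''z'' = 0"
      "arr s' ''a'' = array_of L"
    using 2(2) n L by (auto simp: frame_def)
  have less: "j < length L" using 2(3) j fr by simp
  have sub: "set (take j L) \<subseteq> items I" using L set_take_subset by fastforce
  then have G: "?G \<subseteq> set (take j L)" "?G \<subseteq> items I"
    using greedy_basis(1)[OF I sub] by auto
  \<comment> \<open>Distinctness matters for the undo step: a repeated label that had been selected
    would be erased from the array.\<close>
  have "?x \<notin> set (take j L)"
    using less L(2) by (metis distinct_take not_distinct_conv_prefix take_Suc_conv_app_nth)
  then have x: "?x \<notin> ?G" "?x \<in> items I" using G L less by auto
  have step: "greedy I (take (Suc j) L) = greedy_step I ?G ?x"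
    using less by (simp add: take_Suc_conv_app_nth greedy_def)
  have query: "{i. ((arr s' ''in'')(?x := 1)) i \<noteq> 0} = insert ?x ?G"
    using j(4) by auto
  have orc: "agg_oracle I (insert ?x ?G) = Some (agg I (insert ?x ?G))"
    using x G by (simp add: agg_oracle_def)
  have a: "array_of L j = real ?x" using less by (simp add: array_of_def)
  have m: "m = Suc (length L - Suc j)" using j(1) less by simp
  show ?case
  proof (intro exI conjI)
    show "m = Suc (length L - Suc j)" by fact
    show "wp prim (agg_oracle I) \<tau>
       (Load ''x'' ''a'' ''k'' ;; Store ''in'' ''x'' ''one'' ;; Oracle ''v'' ''in'' ;;
        IfLess ''cur'' ''v'' (Copy ''cur'' ''v'') (Store ''in'' ''x'' ''z'') ;;
        Add ''k'' ''k'' ''one'')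
       (\<lambda>k s''. k \<le> 5 + \<tau> \<and> (\<exists>j'\<le>length L. length L - Suc j = length L - j' \<and>
          var s'' ''k'' = real j' \<and> var s'' ''cur'' = real (agg I (greedy I (take j' L))) \<and>
          arr s'' ''in'' = (\<lambda>i. if i \<in> greedy I (take j' L) then 1 else 0))) s'"
      using j(2,3) fr a query orc less step x(1)
      by (auto intro!: exI[of _ "Suc j"] simp: greedy_step_def fun_eq_iff j(4))
  qed
next
  case (3 m' k s')
  have "var s' ''n'' = real (length L)" using 3(2) n by (auto simp: frame_def)
  then show ?case using 3(1,3,4) by auto
qed

text \<open>In-place compaction of \<open>''item''\<close>. The cell just read is erased before the
  kept label is written, since both positions may coincide.\<close>

definition clean_com :: "'op com" where
  "clean_com = Const ''k'' 0 ;; Const ''m'' 0 ;; Const ''z'' 0 ;;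
     WhileLess ''k'' ''n''
       (Load ''x'' ''item'' ''k'' ;; Store ''item'' ''k'' ''z'' ;; Load ''v'' ''in'' ''x'' ;;
        IfLess ''z'' ''v'' (Store ''item'' ''m'' ''x'' ;; Add ''m'' ''m'' ''one'')
          (Store ''w'' ''x'' ''z'' ;; Store ''p'' ''x'' ''z'') ;;
        Store ''in'' ''x'' ''z'' ;; Store ''a'' ''k'' ''z'' ;; Store ''b'' ''k'' ''z'' ;;
        Add ''k'' ''k'' ''one'')"

definition clean_inv :: "nat set \<Rightarrow> nat list \<Rightarrow> store \<Rightarrow> nat \<Rightarrow> store \<Rightarrow> bool" where
  "clean_inv J L s j s' \<longleftrightarrow> j \<le> length L \<and>
     var s' ''k'' = real j \<and> var s' ''m'' = real (length (filter (\<lambda>i. i \<in> J) (take j L))) \<and>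
     arr s' ''item'' = (\<lambda>i. if i < length (filter (\<lambda>i. i \<in> J) (take j L))
        then real (filter (\<lambda>i. i \<in> J) (take j L) ! i) else if j \<le> i then array_of L i else 0) \<and>
     arr s' ''in'' = (\<lambda>i. if i \<in> J \<and> i \<notin> set (take j L) then 1 else 0) \<and>
     arr s' ''w'' = (\<lambda>i. if i \<in> set (take j L) \<and> i \<notin> J then 0 else arr s ''w'' i) \<and>
     arr s' ''p'' = (\<lambda>i. if i \<in> set (take j L) \<and> i \<notin> J then 0 else arr s ''p'' i) \<and>
     arr s' ''a'' = (\<lambda>i. if i < j then 0 else arr s ''a'' i) \<and>
     arr s' ''b'' = (\<lambda>i. if i < j then 0 else arr s ''b'' i)"

lemma wp_clean_com:
  assumes n: "var s ''n'' = real (length L)" "var s ''one'' = 1"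
    and L: "arr s ''item'' = array_of L" "distinct L"
    and J: "arr s ''in'' = (\<lambda>i. if i \<in> J then 1 else 0)"
  shows "wp prim orc \<tau> clean_com (\<lambda>t s'. t \<le> 4 + 11 * length L \<and> clean_inv J L s (length L) s') s"
  unfolding clean_com_def wp_Seq[of _ _ _ "Const _ _"] wp_elementary
proof (rule wp_WhileLess[where b = 10 and m = "length L" and Inv = "\<lambda>m s'. \<exists>j. m = length L - j \<and>
      clean_inv J L s j s'"], goal_cases)
  case 1
  show ?case using assms by (intro exI[of _ 0]) (simp add: clean_inv_def)
next
  case (2 m s')
  then obtain j where j: "m = length L - j" and inv: "clean_inv J L s j s'" by blast
  note inv' = inv[unfolded clean_inv_def]
  let ?F = "\<lambda>j. filter (\<lambda>i. i \<in> J) (take j L)" and ?x = "L ! j"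
  have fr: "var s' ''n'' = real (length L)" "var s' ''one'' = 1" "var s' ''z'' = 0"
    using 2(2) n by (auto simp: frame_def)
  have less: "j < length L" using 2(3) inv' fr by simp
  \<comment> \<open>The write position never overtakes the read position, so no unread label is
    lost.\<close>
  have le: "length (?F j) \<le> j"
    using length_filter_le[of "\<lambda>i. i \<in> J" "take j L"] less by simp
  have take: "take (Suc j) L = take j L @ [?x]" using less by (simp add: take_Suc_conv_app_nth)
  have x: "?x \<notin> set (take j L)"
    using less L(2) by (metis distinct_take not_distinct_conv_prefix take_Suc_conv_app_nth)
  have a: "array_of L j = real ?x" using less by (simp add: array_of_def)
  have item: "arr s' ''item'' j = real ?x" using inv' le a by simp
  have in_x: "arr s' ''in'' ?x = (if ?x \<in> J then 1 else 0)" using inv' x by simp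
  have "wp prim orc \<tau>
       (Load ''x'' ''item'' ''k'' ;; Store ''item'' ''k'' ''z'' ;; Load ''v'' ''in'' ''x'' ;;
        IfLess ''z'' ''v'' (Store ''item'' ''m'' ''x'' ;; Add ''m'' ''m'' ''one'')
          (Store ''w'' ''x'' ''z'' ;; Store ''p'' ''x'' ''z'') ;;
        Store ''in'' ''x'' ''z'' ;; Store ''a'' ''k'' ''z'' ;; Store ''b'' ''k'' ''z'' ;;
        Add ''k'' ''k'' ''one'') (\<lambda>k s''. k \<le> 10 \<and> clean_inv J L s (Suc j) s'') s'"
  proof (cases "?x \<in> J")
    case True
    then show ?thesis
      using inv' fr item in_x less le x
      by (auto simp: clean_inv_def take fun_eq_iff nth_append)
  next
    case False
    then show ?thesis
      using inv' fr item in_x less le x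
      by (auto simp: clean_inv_def take fun_eq_iff nth_append)
  qed
  moreover have "m = Suc (length L - Suc j)" using j less by simp
  ultimately show ?case by (smt (verit, best) wp_mono)
next
  case (3 m' k s')
  have "var s' ''n'' = real (length L)" using 3(2) n by (auto simp: frame_def)
  then show ?case using 3(1,3,4) by (auto simp: clean_inv_def)
qed

section \<open>Erasing scratch variables and assembling the preprocessing\<close>

fun zero_vars :: "name list \<Rightarrow> 'op com" where
  "zero_vars [] = Skip"
| "zero_vars (x # xs) = Const x 0 ;; zero_vars xs"

lemma wp_zero_vars:
  "wp prim orc \<tau> (zero_vars xs) (\<lambda>t s'. t = Suc (length xs) \<and> arr s' = arr s \<and>
    var s' = (\<lambda>x. if x \<in> set xs then 0 else var s x)) s"
proof (induction xs arbitrary: s)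
  case (Cons x xs)
  show ?case
    unfolding zero_vars.simps wp_Seq wp_elementary
    by (rule wp_mono[OF Cons.IH]) auto
qed simp

text \<open>These are all the variables written before the final erasure, except
  \<open>''n''\<close>.\<close>

definition scratch_vars :: "name list" where
  "scratch_vars = [''k'', ''x'', ''y'', ''wx'', ''wy'', ''i'', ''mid'', ''j'', ''hi'', ''wd'', ''one'',
     ''cur'', ''v'', ''m'', ''z'']"

lemma written_copy_array [simp]:
  "written_vars (copy_array a b) = {''k'', ''x''}" "written_arrs (copy_array a b) = {b}"
  by (auto simp: copy_array_def)

lemma written_sort_com [simp]:
  "written_vars sort_com =
     {''k'', ''x'', ''y'', ''wx'', ''wy'', ''i'', ''mid'', ''j'', ''hi'', ''wd''}"
  "written_arrs sort_com = {''a'', ''b''}"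
  by (auto simp: com_defs)

lemma written_greedy_com [simp]:
  "written_vars greedy_com = {''k'', ''x'', ''cur'', ''v'', ''z''}"
  "written_arrs greedy_com = {''in''}"
  by (auto simp: greedy_com_def)

lemma written_clean_com [simp]:
  "written_vars clean_com = {''k'', ''x'', ''v'', ''m'', ''z''}"
  "written_arrs clean_com = {''item'', ''w'', ''p'', ''in'', ''a'', ''b''}"
  by (auto simp: clean_com_def)

lemma frame_var: "frame c s s' \<Longrightarrow> x \<notin> written_vars c \<Longrightarrow> var s' x = var s x"
  and frame_arr: "frame c s s' \<Longrightarrow> a \<notin> written_arrs c \<Longrightarrow> arr s' a = arr s a"
  by (simp_all add: frame_def)

lemma arr_input_store:
  "arr (input_store I) ''item'' = array_of (sorted_list_of_set (items I))"
  "arr (input_store I) ''w'' = (\<lambda>i. if i \<in> items I then weight I i else 0)"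
  "arr (input_store I) ''p'' = (\<lambda>i. if i \<in> items I then real (profit I i) else 0)"
  "a \<notin> {''item'', ''w'', ''p'', ''Delta'', ''W''} \<Longrightarrow> arr (input_store I) a = (\<lambda>_. 0)"
  by (auto simp: input_store_def array_of_def fun_eq_iff)

lemma arr_input_store_modularize:
  "a \<notin> {''item'', ''w'', ''p''} \<Longrightarrow> arr (input_store (modularize I J)) a = arr (input_store I) a"
  by (auto simp: input_store_def modularize_def)

text \<open>The given algorithm may read any memory cell, so the preprocessing has to leave exactly the
  input store of the modularized instance: dropped items and all scratch memory are erased.\<close>

definition prepare :: "'op com" where
  "prepare = Const ''one'' 1 ;; copy_array ''item'' ''a'' ;; sort_com ;; greedy_com ;; clean_com ;;
     Copy ''n'' ''m'' ;; zero_vars scratch_vars"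

text \<open>The constant 30 adds up 1 for \<open>''one''\<close>, 2 for copying, 2 for sorting, 4
  for the greedy scan, 4 for the clean-up, 1 for \<open>''n''\<close> and 16 for erasing variables;
  21 is 4 + 6 + 11, the cost per item of copying, scanning and cleaning up apart from
  queries.\<close>

lemma wp_prepare:
  assumes I: "ik_aon I" and M: "card (items I) \<le> 2 ^ M"
  shows "wp prim (agg_oracle I) \<tau> prepare (\<lambda>t s'.
    t \<le> 30 + 21 * card (items I) + M * (10 + 25 * card (items I)) + card (items I) * \<tau> \<and>
    (\<exists>xs. set xs = items I \<and> sorted (map (weight I) xs) \<and>
       s' = input_store (modularize I (greedy I xs)))) (input_store I)"
proof -
  define s0 where "s0 = set_var ''one'' 1 (input_store I)"
  define L where "L = sorted_list_of_set (items I)"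
  have fin: "finite (items I)" using finite_items[OF I] .
  have L: "set L = items I" "distinct L" "length L = card (items I)"
    using fin by (simp_all add: L_def)
  have s0: "var s0 ''n'' = real (length L)" "var s0 ''one'' = 1" "arr s0 ''item'' = array_of L"
      "arr s0 ''a'' = (\<lambda>_. 0)" "arr s0 ''b'' = (\<lambda>_. 0)" "arr s0 ''in'' = (\<lambda>_. 0)"
      "arr s0 ''w'' = (\<lambda>i. if i \<in> items I then weight I i else 0)"
      "arr s0 ''p'' = (\<lambda>i. if i \<in> items I then real (profit I i) else 0)"
    using L(3) by (auto simp: s0_def input_store_def array_of_def fun_eq_iff L_def)
  have copy: "wp prim (agg_oracle I) \<tau> (copy_array ''item'' ''a'') (\<lambda>t s'. t \<le> 2 + 4 * length L \<and>
      arr s' ''a'' = (\<lambda>i. if i < length L then arr s0 ''item'' i else arr s0 ''a'' i)) s0"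
    using s0 by (intro wp_copy_array) auto
  show ?thesis
    unfolding prepare_def wp_Seq wp_elementary of_nat_1 s0_def[symmetric]
  proof (rule wp_frame[OF copy], goal_cases)
    case (1 t1 s1)
    note f1 = frame_var[OF 1(2)] frame_arr[OF 1(2)] and t1 = conjunct1[OF 1(1)]
    have "arr s1 ''a'' = array_of L"
      using 1(1) s0 by (simp add: array_of_def fun_eq_iff)
    then have fr1: "var s1 ''n'' = real (length L)" "var s1 ''one'' = 1"
        "arr s1 ''a'' = array_of L" "arr s1 ''b'' = (\<lambda>_. 0)"
      using s0 by (simp_all add: f1)
    have sort: "wp prim (agg_oracle I) \<tau> sort_com (\<lambda>t s'. t \<le> 2 + M * (10 + 25 * length L) \<and>
      (\<exists>L'. arr s' ''a'' = array_of L' \<and> mset L' = mset L \<and> sorted (map (arr s1 ''w'') L') \<and>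
        (\<forall>l\<ge>length L. arr s' ''b'' l = 0))) s1"
      using fr1 M L by (intro wp_sort_com) auto
    show ?case
    proof (rule wp_frame[OF sort], goal_cases)
      case (1 t2 s2)
      then obtain xs where xs: "arr s2 ''a'' = array_of xs" "mset xs = mset L"
          "sorted (map (arr s1 ''w'') xs)" "\<forall>l\<ge>length L. arr s2 ''b'' l = 0"
        by blast
      have perm: "set xs = items I" "length xs = length L" "distinct xs"
        using xs(2) L by (metis set_mset_mset, metis size_mset, metis mset_eq_imp_distinct_iff)
      note f2 = frame_var[OF 1(2)] frame_arr[OF 1(2)] and t2 = conjunct1[OF 1(1)]
      have fr2: "var s2 ''n'' = real (length xs)" "var s2 ''one'' = 1" "arr s2 ''in'' = (\<lambda>_. 0)"
        using s0 perm by (simp_all add: f1 f2)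
      have w1: "arr s1 ''w'' = arr s0 ''w''"
        by (simp add: f1)
      have "map (arr s1 ''w'') xs = map (weight I) xs" using s0 perm w1 by simp
      with xs have sorted: "sorted (map (weight I) xs)" by simp
      let ?J = "greedy I xs"
      have J: "?J \<subseteq> items I" using greedy_basis(1)[OF I, of xs] perm by simp
      have greedy: "wp prim (agg_oracle I) \<tau> greedy_com (\<lambda>t s'. t \<le> 4 + length xs * (6 + \<tau>) \<and>
          arr s' ''in'' = (\<lambda>i. if i \<in> ?J then 1 else 0)) s2"
        using fr2 xs perm by (intro wp_greedy_com[OF I]) auto
      show ?case
      proof (rule wp_frame[OF greedy], goal_cases)
        case (1 t3 s3)
        note f3 = frame_var[OF 1(2)] frame_arr[OF 1(2)] and t3 = conjunct1[OF 1(1)]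
        have arr3: "arr s3 a = arr s0 a" if "a \<notin> {''a'', ''b'', ''in''}" for a
          using that by (simp add: f1 f2 f3)
        have ab3: "arr s3 ''a'' = array_of xs" "arr s3 ''b'' = arr s2 ''b''"
          using xs by (simp_all add: f3)
        have n3: "var s3 ''n'' = real (length L)" "var s3 ''one'' = 1"
          using fr2 perm by (simp_all add: f3)
        have clean: "wp prim (agg_oracle I) \<tau> clean_com
            (\<lambda>t s'. t \<le> 4 + 11 * length L \<and> clean_inv ?J L s3 (length L) s') s3"
          using n3 L 1(1) s0 arr3 by (intro wp_clean_com) auto
        show ?case
        proof (rule wp_frame[OF clean], goal_cases)
          case (1 t4 s4)
          note f4 = frame_var[OF 1(2)] frame_arr[OF 1(2)] and t4 = conjunct1[OF 1(1)]
          let ?I = "modularize I ?J"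
          \<comment> \<open>Sorting acted on a copy in \<open>''a''\<close>, so
            \<open>''item''\<close> is still in increasing label order and filtering it gives the
            listing that the input convention prescribes.\<close>
          have "filter (\<lambda>i. i \<in> ?J) L = sorted_list_of_set ?J"
            using J fin finite_subset[OF J fin]
            by (intro sorted_distinct_set_unique) (auto simp: L_def sorted_wrt_filter)
          then have list: "filter (\<lambda>i. i \<in> ?J) L = sorted_list_of_set (items ?I)"
            by (simp add: modularize_def)
          then have len: "length (filter (\<lambda>i. i \<in> ?J) L) = card (items ?I)" by simp
          note inv = conjunct2[OF 1(1), unfolded clean_inv_def]
          have arr4: "arr s4 a = arr s0 a" if "a \<notin> {''a'', ''b'', ''in'', ''item'', ''w'', ''p''}" for a
            using that arr3 by (simp add: f4)
          have var4: "var s4 x = var s0 x" if "x \<notin> set scratch_vars" for x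
            using that by (simp add: f1 f2 f3 f4 scratch_vars_def)
          have item: "arr s4 ''item'' = array_of (sorted_list_of_set (items ?I))"
            using inv list L(3) by (auto simp: fun_eq_iff array_of_def)
          \<comment> \<open>The clean-up erases \<open>''a''\<close> and \<open>''b''\<close> only
            up to the number of items; beyond it both were still 0 after sorting.\<close>
          have zero: "arr s4 ''a'' = (\<lambda>_. 0)" "arr s4 ''b'' = (\<lambda>_. 0)" "arr s4 ''in'' = (\<lambda>_. 0)"
            using inv ab3 xs(4) perm J L by (auto simp: fun_eq_iff array_of_def)
          have wp3: "arr s3 ''w'' = arr s0 ''w''" "arr s3 ''p'' = arr s0 ''p''"
            by (simp_all add: arr3)
          have "arr s4 ''w'' = (\<lambda>i. if i \<in> items I \<and> i \<notin> ?J then 0 else arr s0 ''w'' i)"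
              "arr s4 ''p'' = (\<lambda>i. if i \<in> items I \<and> i \<notin> ?J then 0 else arr s0 ''p'' i)"
            using inv L(1) unfolding wp3 by simp_all
          then have wp4: "arr s4 ''w'' = (\<lambda>i. if i \<in> ?J then weight I i else 0)"
              "arr s4 ''p'' = (\<lambda>i. if i \<in> ?J then real (profit I i) else 0)"
            using J by (auto simp: s0(7,8) fun_eq_iff)
          have items: "items ?I = ?J" "weight ?I = weight I" "profit ?I = profit I"
            by (simp_all add: modularize_def)
          have arr: "arr s4 = arr (input_store ?I)"
          proof
            fix a
            show "arr s4 a = arr (input_store ?I) a"
            proof (cases "a \<in> {''a'', ''b'', ''in'', ''item'', ''w'', ''p''}")
              case True
              then show ?thesis
                using item zero wp4 by (elim insertE emptyE) (simp_all add: arr_input_store items cong: if_cong)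
            next
              case False
              then show ?thesis
                using arr4[of a] arr_input_store_modularize[of a] by (simp add: s0_def)
            qed
          qed
          have var: "(\<lambda>x. if x \<in> set scratch_vars then 0 else ((var s4)(''n'' := var s4 ''m'')) x) =
              var (input_store ?I)"
          proof
            fix x
            show "(if x \<in> set scratch_vars then 0 else ((var s4)(''n'' := var s4 ''m'')) x) =
              var (input_store ?I) x"
            proof (cases "x \<in> set scratch_vars")
              case True
              then show ?thesis by (auto simp: scratch_vars_def input_store_def)
            next
              case False
              then show ?thesis
                using var4[of x] inv len
                by (auto simp: input_store_def s0_def modularize_def scratch_vars_def)
            qed
          qed
          show ?case
          proof (rule wp_mono[OF wp_zero_vars], goal_cases)
            case (1 t5 s5)
            have "s5 = input_store ?I"
              using 1 arr unfolding var_set_var var by (intro store.equality) auto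
            \<comment> \<open>Fifteen scratch variables and the closing \<open>Skip\<close>.\<close>
            moreover have "t5 = 16" using 1 by (simp add: scratch_vars_def)
            ultimately show ?case
              using t1 t2 t3 t4 perm sorted L(3) by (auto simp: algebra_simps)
          qed
        qed
      qed
    qed
  qed
qed

section \<open>Size and time bounds, and the reduction\<close>

lemma input_size_modularize:
  assumes "finite (items I)" "J \<subseteq> items I"
  shows "input_size len (modularize I J) \<le> input_size len I"
  using assms by (simp add: input_size_def modularize_def sum_mono2)

text \<open>For \<open>3 \<le> n\<close> the logarithm is at least 1 and absorbs the lower-order
  terms: 51 = 30 + 21, 35 = 10 + 25, and \<open>1 / ln 2 + 1\<close> accounts for the change of base
  and the rounding.\<close>

lemma prepare_time_bigo:
  "(\<lambda>n. 30 + 21 * real n + real (nat \<lceil>log 2 (real n)\<rceil>) * (10 + 25 * real n))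
     \<in> O(\<lambda>n. real n * ln (real n))"
proof (rule bigoI[where c = "51 + 35 * (1 / ln 2 + 1)"])
  have "norm (30 + 21 * real n + real (nat \<lceil>log 2 (real n)\<rceil>) * (10 + 25 * real n))
      \<le> (51 + 35 * (1 / ln 2 + 1)) * norm (real n * ln (real n))" if n: "3 \<le> n" for n :: nat
  proof -
    have "exp 1 \<le> real n" using exp_le n by (simp add: order_trans[of _ 3])
    then have ln: "1 \<le> ln (real n)" using n by (subst ln_ge_iff) auto
    have "real (nat \<lceil>log 2 (real n)\<rceil>) \<le> log 2 (real n) + 1"
      using n zero_le_log_cancel_iff[of 2 "real n"] by linarith
    also have "\<dots> \<le> ln (real n) / ln 2 + ln (real n)"
      using ln by (simp add: log_def)
    also have "\<dots> = (1 / ln 2 + 1) * ln (real n)" by (simp add: field_simps)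
    finally have M: "real (nat \<lceil>log 2 (real n)\<rceil>) \<le> (1 / ln 2 + 1) * ln (real n)" .
    have "real (nat \<lceil>log 2 (real n)\<rceil>) * (10 + 25 * real n)
        \<le> ((1 / ln 2 + 1) * ln (real n)) * (35 * real n)"
      using M n ln by (intro mult_mono) (auto intro!: mult_nonneg_nonneg add_nonneg_nonneg)
    moreover have "30 + 21 * real n \<le> 51 * (real n * ln (real n))"
    proof -
      have "30 + 21 * real n \<le> 51 * (real n * 1)" using n by simp
      also have "\<dots> \<le> 51 * (real n * ln (real n))"
        using ln by (intro mult_left_mono) auto
      finally show ?thesis .
    qed
    ultimately have "30 + 21 * real n + real (nat \<lceil>log 2 (real n)\<rceil>) * (10 + 25 * real n)
        \<le> (51 + 35 * (1 / ln 2 + 1)) * (real n * ln (real n))"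
      by (simp add: algebra_simps)
    then show ?thesis using ln by simp
  qed
  then show "\<forall>\<^sub>F n in sequentially.
      norm (30 + 21 * real n + real (nat \<lceil>log 2 (real n)\<rceil>) * (10 + 25 * real n))
      \<le> (51 + 35 * (1 / ln 2 + 1)) * norm (real n * ln (real n))"
    by (rule eventually_sequentiallyI)
qed

text \<open>This supplies the number of rounds for the merge sort.\<close>

lemma le_two_power_ceiling_log: "n \<le> 2 ^ nat \<lceil>log 2 (real n)\<rceil>"
proof (cases "n = 0")
  case False
  have "real n = 2 powr (log 2 (real n))" using False by simp
  also have "\<dots> \<le> 2 powr real (nat \<lceil>log 2 (real n)\<rceil>)"
    by (intro powr_mono) linarith+
  also have "\<dots> = real (2 ^ nat \<lceil>log 2 (real n)\<rceil>)" by (simp add: powr_realpow)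
  finally show ?thesis by (simp only: of_nat_le_iff)
qed simp

theorem theorem1:
  fixes C :: "ik_instance set"
    and \<alpha> :: real
    and q :: "nat \<Rightarrow> real"
    and len :: "real \<Rightarrow> nat"
    and prim :: "'op \<Rightarrow> real \<Rightarrow> real \<Rightarrow> real"
  assumes "\<forall>I\<in>C. ik_aon I"
    and "0 \<le> \<alpha>" and "\<alpha> \<le> 1"
    and "mono q"
    and "\<exists>A :: 'op com. \<forall>J\<in>modularizations C.
           solves_within prim Map.empty 0 A \<alpha> J (q (input_size len J))"
  shows "\<exists>(B :: 'op com) (g :: nat \<Rightarrow> real).
           g \<in> O(\<lambda>n. real n * ln (real n)) \<and>
           (\<forall>I\<in>C. \<forall>\<tau>.
              solves_within prim (agg_oracle I) \<tau> B \<alpha> I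
                (q (input_size len I) + g (card (items I)) + real (card (items I)) * real \<tau>))"
proof -
  obtain A :: "'op com" where A: "\<And>J. J \<in> modularizations C \<Longrightarrow>
      solves_within prim Map.empty 0 A \<alpha> J (q (input_size len J))"
    using assms(5) by blast
  define g where "g n = 30 + 21 * real n + real (nat \<lceil>log 2 (real n)\<rceil>) * (10 + 25 * real n)" for n
  have "solves_within prim (agg_oracle I) \<tau> (prepare ;; A) \<alpha> I
      (q (input_size len I) + g (card (items I)) + real (card (items I)) * real \<tau>)"
    if "I \<in> C" for I \<tau>
  proof -
    have I: "ik_aon I" using assms(1) that by blast
    let ?n = "card (items I)"
    let ?M = "nat \<lceil>log 2 (real ?n)\<rceil>"
    obtain t s xs where t: "exec prim (agg_oracle I) \<tau> prepare (input_store I) t s"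
        "t \<le> 30 + 21 * ?n + ?M * (10 + 25 * ?n) + ?n * \<tau>"
        and xs: "set xs = items I" "sorted (map (weight I) xs)"
        and s: "s = input_store (modularize I (greedy I xs))"
      using wp_prepare[OF I le_two_power_ceiling_log, of prim \<tau>] unfolding wp_def by blast
    let ?I = "modularize I (greedy I xs)"
    have J: "greedy I xs \<subseteq> items I" using greedy_basis(1)[OF I, of xs] xs by simp
    then have "?I \<in> modularizations C"
      unfolding modularizations_def modularize_def using that by blast
    then obtain k s' where k: "exec prim Map.empty 0 A s k s'" "real k \<le> q (input_size len ?I)"
        "approx_solution \<alpha> ?I (output_chain s')"
      using A s unfolding solves_within_def by blast
    \<comment> \<open>\<open>A\<close> starts in exactly the store of the modularized instance, and
      its oracle-free run is also a run in the presence of the oracle.\<close>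
    have "exec prim (agg_oracle I) \<tau> (prepare ;; A) (input_store I) (t + k) s'"
      using t(1) exec_without_oracle[OF k(1)] by (rule exec.Seq)
    moreover have "real (t + k) \<le> q (input_size len I) + g ?n + real ?n * real \<tau>"
    proof -
      \<comment> \<open>Dropping items does not enlarge the input, and monotonicity of
        \<open>q\<close> carries this over to the time bound.\<close>
      have "q (input_size len ?I) \<le> q (input_size len I)"
        using input_size_modularize[OF finite_items[OF I] J] assms(4) by (auto dest: monoD)
      moreover have "real t \<le> real (30 + 21 * ?n + ?M * (10 + 25 * ?n) + ?n * \<tau>)"
        using t(2) by (simp only: of_nat_le_iff)
      then have "real t \<le> g ?n + real ?n * real \<tau>" by (simp add: g_def)
      ultimately show ?thesis using k(2) by simp
    qed
    moreover have "approx_solution \<alpha> I (output_chain s')"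
      using modular_approx_solution[OF I xs assms(2) k(3)] .
    ultimately show ?thesis unfolding solves_within_def by blast
  qed
  moreover have "g \<in> O(\<lambda>n. real n * ln (real n))"
    using prepare_time_bigo by (simp add: g_def[abs_def])
  ultimately show ?thesis by blast
qed

end
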